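(* Let $k\ge1$, $0\le n,m\le k$, let $a,b,c,d$ be heights with $a-b=k-2n$ and $c-d=k-2m$, and set $$\alpha=\frac{-u+a-k+1}{2},\quad \beta=\frac{-u-a-k+1}{2},\quad \gamma=\frac{-u+c-k+1}{2},\quad \delta=\frac{-u-c-k+1}{2}.$$ Then $$R_n^m(\alpha,\beta,\gamma,\delta;k;q,p)=\sum_{\mu\in\{-k,-k+2,\dots,k\}}\psi^{*(k)}_\mu(u)^d_c\,\psi^{(k)}_\mu(u)^a_b.$$
   Context: Theta functions. Fix $\tau\in\mathbb{C}$ with $\mathrm{Im}\,\tau>0$ and a nonzero parameter $r$; put $\tilde p=e^{2\pi i\tau}$, $x=e^{-\pi i/(r\tau)}$ (powers $x^s=e^{-\pi i s/(r\tau)}$), $q=-x$, $p=x^{2r}$ (the letters $q,p$ in $R_n^m$ only record these fixed parameters). Let $\vartheta_1(u|\tau)=2\tilde p^{1/8}(\tilde p;\tilde p)_\infty\sin\pi u\prod_{n\ge1}(1-2\tilde p^n\cos 2\pi u+\tilde p^{2n})$, $\vartheta_0(u|\tau)=-ie^{\pi i(u+\tau/4)}\vartheta_1(u+\frac{\tau}{2}|\tau)$, $\vartheta_3(u|\tau)=e^{\pi i(u+\tau/4)}\vartheta_1(u+\frac{\tau+1}{2}|\tau)$. Set $[u]=C\,\vartheta_1(\frac{u}{r}|\tau)$ with $C=x^{-r/4}e^{-\pi i/4}\tau^{1/2}$, and $[u]_n=\prod_{j=0}^{n-1}[u+j]$. Elliptic $6j$-symbols. Let $\Theta_k$ be the $(k+1)$-dimensional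 space of entire $f$ with $f(z+1)=f(z)$, $f(z+\tau)=e^{-2\pi ik(2z+\tau)}f(z)$, $f(-z)=f(z)$. For $0\le n\le k$ put $e^k_n(z;\alpha,\beta)=[\alpha+rz]_n[\alpha-rz]_n[\beta+rz]_{k-n}[\beta-rz]_{k-n}\in\Theta_k$. The vectors $\{e_m^k(z;\gamma,\delta)\}_{m=0}^k$ form a basis of $\Theta_k$ (natural basis) if $\frac{\gamma-\delta+j}{r}\notin\mathbb{Z}+\tau\mathbb{Z}$ for $j=1-k,\dots,k-1$ and $\frac{\gamma+\delta+j}{r}\notin\mathbb{Z}+\tau\mathbb{Z}$ for $j=0,\dots,k-1$. The coefficients $R_n^m$ are defined by $$e^k_n(z;\alpha,\beta)=\sum_{m=0}^kR_n^m(\alpha,\beta,\gamma,\delta;k;q,p)\,e^k_m(z;\gamma,\delta).$$ Intertwining vectors. Heights are integers. For heights with $|a-b|=1$ let $\psi_+(u)^a_b=\vartheta_0\big(\frac{(a-b)u+a}{2r}\big|\frac{\tau}{2}\big)$, $\psi_-(u)^a_b=\vartheta_3\big(\frac{(a-b)u+a}{2r}\big|\frac{\tau}{2}\big)$, and, for $\varepsilon=\pm$ (identified with $\pm1$), $\psi^*_\varepsilon(u)^a_b=-\varepsilon\,\frac{a-b}{2[b][u]}\,C^2\,\psi_{-\varepsilon}(u-1)^a_b$. Fusion. For $a-b\in\{-k,-k+2,\dots,k\}$ and $\mu\in\{-k,-k+2,\dots,k\}$, $$\psi^{(k)}_\mu(u)^a_b=\sum_{\varepsilon_1+\cdots+\varepsilon_k=\mu}\psi_{\varepsilon_1}(u+k-1)^a_{c_1}\psi_{\varepsilon_2}(u+k-2)^{c_1}_{c_2}\cdots\psi_{\varepsilon_k}(u)^{c_{k-1}}_b,$$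 which is independent of the choice of $c_1,\dots,c_{k-1}$ with $|a-c_1|=|c_1-c_2|=\cdots=|c_{k-1}-b|=1$; and $$\psi^{*(k)}_\mu(u)^b_a=\sum_{c_1,\dots,c_{k-1}}\psi^*_{\varepsilon_1}(u+k-1)^{c_1}_a\psi^*_{\varepsilon_2}(u+k-2)^{c_2}_{c_1}\cdots\psi^*_{\varepsilon_k}(u)^b_{c_{k-1}},$$ summed over all $c_1,\dots,c_{k-1}$ with consecutive heights in $a,c_1,\dots,c_{k-1},b$ differing by $\pm1$, which is independent of the choice of $\varepsilon_1,\dots,\varepsilon_k\in\{\pm1\}$ with $\varepsilon_1+\cdots+\varepsilon_k=\mu$. Genericity. The basis conditions above are assumed for the pair $(\gamma,\delta)$, i.e. $\frac{c+j}{r}\notin\mathbb{Z}+\tau\mathbb{Z}$ for $j=1-k,\dots,k-1$ and $\frac{u+j}{r}\notin\mathbb{Z}+\tau\mathbb{Z}$ for $j=0,\dots,k-1$; then no denominator in $\psi^{*(k)}_\mu(u)^d_c$ vanishes. *)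

theory Defs
  imports "HOL-Analysis.Analysis"
begin

(* The parameters tau and r are explicit arguments throughout.  The nomes
   q = -x and p = x^(2r) are functions of tau and r and do not occur separately. *)

subsection \<open>Theta functions\<close>

definition theta1 :: "complex \<Rightarrow> complex \<Rightarrow> complex" where
  "theta1 u \<tau> =
     (let pt = exp (2 * of_real pi * \<i> * \<tau>) in
      2 * exp (2 * of_real pi * \<i> * \<tau> / 8) * (\<Prod>n. 1 - pt ^ Suc n) * sin (of_real pi * u)
        * (\<Prod>n. 1 - 2 * pt ^ Suc n * cos (2 * of_real pi * u) + pt ^ (2 * Suc n)))"

definition theta0 :: "complex \<Rightarrow> complex \<Rightarrow> complex" where
  "theta0 u \<tau> = - \<i> * exp (of_real pi * \<i> * (u + \<tau> / 4)) * theta1 (u + \<tau> / 2) \<tau>"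

definition theta3 :: "complex \<Rightarrow> complex \<Rightarrow> complex" where
  "theta3 u \<tau> = exp (of_real pi * \<i> * (u + \<tau> / 4)) * theta1 (u + (\<tau> + 1) / 2) \<tau>"

definition x_pow :: "complex \<Rightarrow> complex \<Rightarrow> complex \<Rightarrow> complex" where
  "x_pow \<tau> r s = exp (- of_real pi * \<i> * s / (r * \<tau>))"

(* tau^(1/2) is the principal root. *)
definition theta_const :: "complex \<Rightarrow> complex \<Rightarrow> complex" where
  "theta_const \<tau> r = x_pow \<tau> r (- r / 4) * exp (- of_real pi * \<i> / 4) * csqrt \<tau>"

definition bracket :: "complex \<Rightarrow> complex \<Rightarrow> complex \<Rightarrow> complex" where
  "bracket \<tau> r u = theta_const \<tau> r * theta1 (u / r) \<tau>"

definition bracket_poch :: "complex \<Rightarrow> complex \<Rightarrow> complex \<Rightarrow> nat \<Rightarrow> complex" where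
  "bracket_poch \<tau> r u n = (\<Prod>j<n. bracket \<tau> r (u + of_nat j))"

definition period_lattice :: "complex \<Rightarrow> complex set" where
  "period_lattice \<tau> = {of_int s + of_int t * \<tau> | s t. True}"

subsection \<open>Elliptic 6j-symbols\<close>

definition nat_basis ::
    "complex \<Rightarrow> complex \<Rightarrow> nat \<Rightarrow> nat \<Rightarrow> complex \<Rightarrow> complex \<Rightarrow> complex \<Rightarrow> complex" where
  "nat_basis \<tau> r k n \<alpha> \<beta> z =
     bracket_poch \<tau> r (\<alpha> + r * z) n * bracket_poch \<tau> r (\<alpha> - r * z) n
     * bracket_poch \<tau> r (\<beta> + r * z) (k - n) * bracket_poch \<tau> r (\<beta> - r * z) (k - n)"

(* R_n^m is the m-th coefficient of e_n^k(.;alpha,beta) in the natural basis for (gamma,delta).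
   The coefficient family (extensional, i.e. undefined beyond k) is unique whenever
   that family of functions is a basis. *)
definition elliptic_6j ::
    "complex \<Rightarrow> complex \<Rightarrow> nat \<Rightarrow> nat \<Rightarrow> nat \<Rightarrow> complex \<Rightarrow> complex \<Rightarrow> complex \<Rightarrow> complex \<Rightarrow> complex" where
  "elliptic_6j \<tau> r k n m \<alpha> \<beta> \<gamma> \<delta> =
     (THE R. R \<in> extensional {..k} \<and>
        (\<forall>z. nat_basis \<tau> r k n \<alpha> \<beta> z = (\<Sum>l\<le>k. R l * nat_basis \<tau> r k l \<gamma> \<delta> z))) m"

subsection \<open>Intertwining vectors\<close>

(* Signs are the integers 1 and -1.  In psi and psi_star the first height is
   the upper index and the second the lower one; the heights are meant to
   differ by 1. *)
definition psi :: "complex \<Rightarrow> complex \<Rightarrow> int \<Rightarrow> complex \<Rightarrow> int \<Rightarrow> int \<Rightarrow> complex" where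
  "psi \<tau> r \<epsilon> u a b =
     (let v = (of_int (a - b) * u + of_int a) / (2 * r) in
      if \<epsilon> = 1 then theta0 v (\<tau> / 2) else theta3 v (\<tau> / 2))"

definition psi_star :: "complex \<Rightarrow> complex \<Rightarrow> int \<Rightarrow> complex \<Rightarrow> int \<Rightarrow> int \<Rightarrow> complex" where
  "psi_star \<tau> r \<epsilon> u a b =
     - of_int \<epsilon> * (of_int (a - b) / (2 * bracket \<tau> r (of_int b) * bracket \<tau> r u))
       * (theta_const \<tau> r)\<^sup>2 * psi \<tau> r (- \<epsilon>) (u - 1) a b"

subsection \<open>Fusion\<close>

definition spins :: "nat \<Rightarrow> int set" where
  "spins k = (\<lambda>j. 2 * int j - int k) ` {..k}"

(* The sign eps_(i+1) of the mathematical notation is eps i here, for i < k. *)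
definition sign_seqs :: "nat \<Rightarrow> int \<Rightarrow> (nat \<Rightarrow> int) set" where
  "sign_seqs k \<mu> = {\<epsilon> \<in> {..<k} \<rightarrow>\<^sub>E {-1, 1}. (\<Sum>i<k. \<epsilon> i) = \<mu>}"

definition height_paths :: "nat \<Rightarrow> int \<Rightarrow> int \<Rightarrow> (nat \<Rightarrow> int) set" where
  "height_paths k a b =
     {h \<in> extensional {..k}. h 0 = a \<and> h k = b \<and> (\<forall>i<k. \<bar>h i - h (Suc i)\<bar> = 1)}"

lemma finite_sign_seqs: "finite (sign_seqs k \<mu>)"
  unfolding sign_seqs_def by (rule finite_subset[of _ "{..<k} \<rightarrow>\<^sub>E {-1, 1}"]) (auto intro: finite_PiE)

lemma finite_height_paths: "finite (height_paths k a b)"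
proof (rule finite_subset)
  show "height_paths k a b \<subseteq> {..k} \<rightarrow>\<^sub>E {a - int k..a + int k}"
  proof
    fix h assume h: "h \<in> height_paths k a b"
    have "\<bar>h i - a\<bar> \<le> int i" if "i \<le> k" for i
      using that
    proof (induction i)
      case 0
      then show ?case using h by (simp add: height_paths_def)
    next
      case (Suc i)
      have "\<bar>h i - h (Suc i)\<bar> = 1"
        using h Suc.prems by (simp add: height_paths_def)
      then show ?case using Suc by simp
    qed
    then have "h i \<in> {a - int k..a + int k}" if "i \<le> k" for i
      using that by (fastforce simp: abs_le_iff)
    then show "h \<in> {..k} \<rightarrow>\<^sub>E {a - int k..a + int k}"
      using h by (auto simp: height_paths_def PiE_def)
  qed
  show "finite ({..k} \<rightarrow>\<^sub>E {a - int k..a + int k})"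
    by (intro finite_PiE) auto
qed

definition psi_along ::
    "complex \<Rightarrow> complex \<Rightarrow> nat \<Rightarrow> int \<Rightarrow> complex \<Rightarrow> (nat \<Rightarrow> int) \<Rightarrow> complex" where
  "psi_along \<tau> r k \<mu> u h =
     (\<Sum>\<epsilon>\<in>sign_seqs k \<mu>. \<Prod>i<k. psi \<tau> r (\<epsilon> i) (u + of_nat (k - 1 - i)) (h i) (h (Suc i)))"

(* The common value over all admissible intermediate heights; a is the upper
   and b the lower height. *)
definition psi_fused ::
    "complex \<Rightarrow> complex \<Rightarrow> nat \<Rightarrow> int \<Rightarrow> complex \<Rightarrow> int \<Rightarrow> int \<Rightarrow> complex" where
  "psi_fused \<tau> r k \<mu> u a b = the_elem (psi_along \<tau> r k \<mu> u ` height_paths k a b)"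

definition psi_star_along ::
    "complex \<Rightarrow> complex \<Rightarrow> nat \<Rightarrow> (nat \<Rightarrow> int) \<Rightarrow> complex \<Rightarrow> int \<Rightarrow> int \<Rightarrow> complex" where
  "psi_star_along \<tau> r k \<epsilon> u b a =
     (\<Sum>h\<in>height_paths k a b.
        \<Prod>i<k. psi_star \<tau> r (\<epsilon> i) (u + of_nat (k - 1 - i)) (h (Suc i)) (h i))"

(* The common value over all sign sequences of total mu; b is the upper and a
   the lower height, and paths start at the lower height. *)
definition psi_star_fused ::
    "complex \<Rightarrow> complex \<Rightarrow> nat \<Rightarrow> int \<Rightarrow> complex \<Rightarrow> int \<Rightarrow> int \<Rightarrow> complex" where
  "psi_star_fused \<tau> r k \<mu> u b a =
     the_elem ((\<lambda>\<epsilon>. psi_star_along \<tau> r k \<epsilon> u b a) ` sign_seqs k \<mu>)"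

end

theory Submission
  imports Defs "HOL-Library.Function_Algebras"
begin

text \<open>
  Write \<open>X\<^sub>+(z)\<close> and \<open>X\<^sub>-(z)\<close> for suitable multiples of \<open>\<vartheta>\<^sub>3(z|\<tau>/2)\<close> and \<open>\<vartheta>\<^sub>0(z|\<tau>/2)\<close>.
  The whole proof rests on one identity, the addition formula (\<open>theta_addition\<close>)

    \<open>\<vartheta>\<^sub>0(v|\<tau>/2) \<vartheta>\<^sub>3(w|\<tau>/2) - \<vartheta>\<^sub>3(v|\<tau>/2) \<vartheta>\<^sub>0(w|\<tau>/2) = 2 \<vartheta>\<^sub>1(v+w|\<tau>) \<vartheta>\<^sub>1(v-w|\<tau>)\<close>.

  It says that, up to a constant, a factor \<open>[y+rz][y-rz]\<close> is a \<open>2 \<times> 2\<close> determinant of theta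
  functions.  With
  \<open>y = ((a-b)u+a)/2\<close> for neighbouring heights \<open>a\<close>, \<open>b\<close>, expanding the determinant gives
  \<open>[y+rz][y-rz] = \<Sum>\<^sub>\<epsilon> \<psi>\<^sub>\<epsilon>(u) X\<^sub>\<epsilon>(z)\<close> (\<open>step_fun_eq_sum_psi\<close>), and the Pluecker relation between three
  vectors of a plane inverts this: \<open>X\<^sub>\<epsilon>(z)\<close> is the sum over both neighbours of \<open>c\<close> of \<open>\<psi>\<^sup>*\<^sub>\<epsilon>(u)\<close> times
  the factor of that neighbour (\<open>spin_fun_eq_sum_psi_star\<close>).

  Now take a path of heights of length \<open>k\<close> and let the spectral parameter run through
  \<open>u+k-1, ..., u\<close>.  The product of its \<open>k\<close> factors depends only on the end points and is the
  function \<open>e\<^sub>n\<close> of the natural basis (\<open>path_product_nat_basis\<close>): each up step supplies the next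
  factor of the \<open>\<alpha>\<close>-products and each down step the next one of the \<open>\<beta>\<close>-products.  Expanding every
  factor along a path from \<open>a\<close> to \<open>b\<close> gives \<open>e\<^sub>n(z;\<alpha>,\<beta>) = \<Sum>\<^sub>\<mu> \<psi>\<^sub>\<mu> X\<^sub>\<mu>(z)\<close>, where \<open>X\<^sub>\<mu>\<close> is the monomial
  in \<open>X\<^sub>+\<close>, \<open>X\<^sub>-\<close> of degree \<open>k\<close> and weight \<open>\<mu>\<close>.  Replacing the factors of a monomial one after the other
  by the inverse relation, and summing over all paths that start at \<open>c\<close>, gives
  \<open>X\<^sub>\<mu>(z) = \<Sum>\<^sub>l \<psi>\<^sup>*\<^sub>\<mu> e\<^sub>l(z;\<gamma>,\<delta>)\<close>, where \<open>l\<close> records the end point.  Substituting one expansion into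
  the other is the assertion.

  What remains is linear algebra.  The \<open>k+1\<close> monomials are linearly independent because
  \<open>\<vartheta>\<^sub>0/\<vartheta>\<^sub>3\<close> takes infinitely many values; this makes the fused \<open>\<psi>\<close> independent of the chosen
  path.  The \<open>k+1\<close> functions \<open>e\<^sub>l(z;\<gamma>,\<delta>)\<close> span them, hence are independent as well; this makes the
  fused \<open>\<psi>\<^sup>*\<close> independent of the chosen signs and the \<open>6j\<close>-coefficients unique.

  The addition formula itself is a rearrangement of double series, once the product that defines
  \<open>\<vartheta>\<^sub>1\<close> is turned into a series by the Jacobi triple product.
\<close>

section \<open>The Jacobi triple product\<close>

definition q_pochhammer :: "complex \<Rightarrow> nat \<Rightarrow> complex" where
  "q_pochhammer p n = (\<Prod>i<n. 1 - p ^ Suc i)"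

text \<open>
  The value \<open>0\<close> for \<open>j > n\<close> lets Pascal's rule hold at \<open>j = n\<close> too.
\<close>
definition gauss_binomial :: "complex \<Rightarrow> nat \<Rightarrow> nat \<Rightarrow> complex" where
  "gauss_binomial p n j = (if j \<le> n then q_pochhammer p n / (q_pochhammer p j * q_pochhammer p (n - j)) else 0)"

lemma power_neq_one: "norm (p::complex) < 1 \<Longrightarrow> p ^ Suc i \<noteq> 1"
  by (metis norm_one norm_power power_less_one_iff norm_ge_zero less_irrefl zero_less_Suc)

lemma q_pochhammer_nonzero: "norm p < 1 \<Longrightarrow> q_pochhammer p n \<noteq> 0"
  using power_neq_one[of p] by (auto simp: q_pochhammer_def)

text \<open>
  Split \<open>1 - p\<^bsup>n+1\<^esup>\<close>, the new factor of the numerator, as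
  \<open>(1 - p\<^bsup>n-j\<^esup>) + p\<^bsup>n-j\<^esup> (1 - p\<^bsup>j+1\<^esup>)\<close>; each part cancels one factor of the denominator.
\<close>
lemma gauss_binomial_Pascal:
  assumes p: "norm p < 1" and j: "j \<le> n"
  shows "gauss_binomial p (Suc n) (Suc j) = gauss_binomial p n (Suc j) + p ^ (n - j) * gauss_binomial p n j"
proof (cases "j = n")
  case True
  then show ?thesis
    using q_pochhammer_nonzero[OF p, of n] q_pochhammer_nonzero[OF p, of "Suc n"]
    by (simp add: gauss_binomial_def)
next
  case False
  then obtain d where n: "n = j + Suc d"
    using j less_imp_Suc_add[of j n] by auto
  have *: "1 - p ^ Suc i \<noteq> 0" for i
    using power_neq_one[OF p, of i] by simp
  define A where "A = 1 - p ^ Suc j"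
  define B where "B = 1 - p ^ Suc d"
  define F where "F = q_pochhammer p j"
  define G where "G = q_pochhammer p d"
  define N where "N = q_pochhammer p (j + Suc d)"
  have nz: "A \<noteq> 0" "B \<noteq> 0" "F \<noteq> 0" "G \<noteq> 0"
    using *[of j] *[of d] q_pochhammer_nonzero[OF p] by (auto simp: A_def B_def F_def G_def)
  have eqs: "q_pochhammer p (Suc j) = F * A" "q_pochhammer p (Suc d) = G * B"
    "q_pochhammer p (Suc (j + Suc d)) = N * (1 - p ^ Suc (j + Suc d))"
    by (simp_all add: q_pochhammer_def A_def B_def F_def G_def N_def)
  have "1 - p ^ Suc (j + Suc d) = B + p ^ Suc d * A"
    by (simp add: A_def B_def algebra_simps power_add)
  then have "N * (1 - p ^ Suc (j + Suc d)) / (F * A * (G * B))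
      = N / (F * A * G) + p ^ Suc d * (N / (F * (G * B)))"
    using nz by (simp add: divide_simps) (simp add: algebra_simps)
  moreover have "gauss_binomial p (Suc n) (Suc j) = N * (1 - p ^ Suc (j + Suc d)) / (F * A * (G * B))"
    "gauss_binomial p n (Suc j) = N / (F * A * G)" "gauss_binomial p n j = N / (F * (G * B))"
    using eqs unfolding gauss_binomial_def n by (simp_all add: N_def F_def G_def)
  ultimately show ?thesis
    by (simp add: n)
qed

lemma q_binomial_theorem:
  assumes p: "norm p < 1"
  shows "(\<Prod>k<n. 1 + t * p ^ k) = (\<Sum>j\<le>n. gauss_binomial p n j * p ^ (j choose 2) * t ^ j)"
proof (induction n)
  case 0
  then show ?case by (simp add: gauss_binomial_def q_pochhammer_def binomial_eq_0)
next
  case (Suc n)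
  have q0: "gauss_binomial p m 0 = 1" for m
    using q_pochhammer_nonzero[OF p] by (simp add: gauss_binomial_def q_pochhammer_def)
  have top: "gauss_binomial p n (Suc n) = 0"
    by (simp add: gauss_binomial_def)
  have ch: "Suc j choose 2 = j + (j choose 2)" for j
    by (simp add: numeral_2_eq_2)
  have "(\<Sum>j\<le>Suc n. gauss_binomial p (Suc n) j * p ^ (j choose 2) * t ^ j)
      = 1 + (\<Sum>j\<le>n. gauss_binomial p (Suc n) (Suc j) * p ^ (Suc j choose 2) * t ^ Suc j)"
    by (subst sum.atMost_Suc_shift) (simp add: q0 binomial_eq_0)
  also have "(\<Sum>j\<le>n. gauss_binomial p (Suc n) (Suc j) * p ^ (Suc j choose 2) * t ^ Suc j)
     = (\<Sum>j\<le>n. gauss_binomial p n (Suc j) * p ^ (Suc j choose 2) * t ^ Suc j)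
       + (\<Sum>j\<le>n. t * p ^ n * (gauss_binomial p n j * p ^ (j choose 2) * t ^ j))"
    unfolding sum.distrib[symmetric]
  proof (rule sum.cong, rule refl)
    fix j assume j: "j \<in> {..n}"
    then have "p ^ n = p ^ (n - j) * p ^ j"
      by (simp flip: power_add)
    then show "gauss_binomial p (Suc n) (Suc j) * p ^ (Suc j choose 2) * t ^ Suc j
      = gauss_binomial p n (Suc j) * p ^ (Suc j choose 2) * t ^ Suc j
        + t * p ^ n * (gauss_binomial p n j * p ^ (j choose 2) * t ^ j)"
      using j by (simp add: gauss_binomial_Pascal[OF p] ch power_add algebra_simps)
  qed
  also have "1 + ((\<Sum>j\<le>n. gauss_binomial p n (Suc j) * p ^ (Suc j choose 2) * t ^ Suc j)
       + (\<Sum>j\<le>n. t * p ^ n * (gauss_binomial p n j * p ^ (j choose 2) * t ^ j)))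
     = (\<Sum>j\<le>Suc n. gauss_binomial p n j * p ^ (j choose 2) * t ^ j)
       + t * p ^ n * (\<Sum>j\<le>n. gauss_binomial p n j * p ^ (j choose 2) * t ^ j)"
    unfolding sum.atMost_Suc_shift[of "\<lambda>j. gauss_binomial p n j * p ^ (j choose 2) * t ^ j"]
    by (simp add: q0 binomial_eq_0 sum_distrib_left)
  also have "\<dots> = (\<Prod>k<Suc n. 1 + t * p ^ k)"
    by (simp add: Suc.IH top algebra_simps)
  finally show ?case by simp
qed

lemma prod_lessThan_add: "(\<Prod>k<m + n. f k) = (\<Prod>k<m. f k) * (\<Prod>k<n::nat. f (m + k))"
  by (induction n) (simp_all add: mult.assoc)

text \<open>
  The q-binomial theorem with \<open>2n\<close> factors and \<open>t = p\<^bsup>1-n\<^esup> e\<^sup>Z\<close>: the exponents of \<open>p\<close> in the factors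
  then run through \<open>1-n, ..., n\<close>.  The half with nonpositive exponents is turned round by
  \<open>1 + w = w (1 + 1/w)\<close>.  Working with \<open>P\<close> and \<open>Z\<close> instead of \<open>p = e\<^sup>P\<close> and \<open>e\<^sup>Z\<close> gives a meaning to
  negative and half-integral powers and turns identities of powers into identities of exponents.
\<close>
lemma finite_Jacobi_triple_product:
  fixes P Z :: complex
  assumes P: "Re P < 0"
  defines "p \<equiv> exp P"
  shows "(\<Prod>k<n. 1 + p ^ k * exp (- Z)) * (\<Prod>k<n. 1 + p ^ Suc k * exp Z)
       = (\<Sum>i\<in>{- int n..int n}.
            gauss_binomial p (2 * n) (nat (int n + i)) * exp (of_int i * (of_int i + 1) / 2 * P + of_int i * Z))"
    (is "?L = ?R")
proof -
  have p: "norm p < 1"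
    using P by (simp add: p_def)
  define t where "t = exp (Z + (1 - of_nat n) * P)"
  \<comment> \<open>the product of the monomials \<open>w\<close> split off; it is cancelled in the end\<close>
  define M where "M = exp (of_nat n * Z - of_nat n * (of_nat n - 1) / 2 * P)"
  have M: "M \<noteq> 0" by (simp add: M_def)
  have pk: "p ^ k = exp (of_nat k * P)" for k
    by (simp add: p_def exp_of_nat_mult)
  have choose2: "(of_nat (j choose 2) :: complex) = of_nat j * (of_nat j - 1) / 2" for j
    by (induction j) (simp_all add: numeral_2_eq_2 field_simps)
  have gauss: "(\<Prod>k<n. exp (Z - of_nat k * P)) = M"
  proof -
    have "(\<Prod>k<m. exp (Z - of_nat k * P)) = exp (of_nat m * Z - of_nat m * (of_nat m - 1) / 2 * P)" for m
      by (induction m) (simp_all add: field_simps flip: exp_add)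
    then show ?thesis by (simp add: M_def)
  qed
  have "(\<Prod>k<2 * n. 1 + t * p ^ k) = (\<Prod>k<n. 1 + t * p ^ k) * (\<Prod>k<n. 1 + t * p ^ (n + k))"
    using prod_lessThan_add[of "\<lambda>k. 1 + t * p ^ k" n n] by (simp add: mult_2)
  also have "(\<Prod>k<n. 1 + t * p ^ k) = (\<Prod>k<n. 1 + t * p ^ (n - 1 - k))"
    by (subst prod.nat_diff_reindex[symmetric]) simp
  also have "\<dots> = (\<Prod>k<n. exp (Z - of_nat k * P) * (1 + p ^ k * exp (- Z)))"
  proof (rule prod.cong, rule refl)
    fix k assume k: "k \<in> {..<n}"
    then have c: "(of_nat (n - 1 - k) :: complex) = of_nat n - 1 - of_nat k"
      by (simp add: of_nat_diff)
    have "t * p ^ (n - 1 - k) = exp (Z - of_nat k * P)"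
      unfolding pk t_def c exp_add[symmetric] by (simp add: algebra_simps)
    moreover have "exp (Z - of_nat k * P) * (p ^ k * exp (- Z)) = 1"
      unfolding pk by (simp flip: exp_add)
    ultimately show "1 + t * p ^ (n - 1 - k) = exp (Z - of_nat k * P) * (1 + p ^ k * exp (- Z))"
      by (simp add: distrib_left)
  qed
  also have "\<dots> = M * (\<Prod>k<n. 1 + p ^ k * exp (- Z))"
    by (simp add: prod.distrib gauss)
  also have "(\<Prod>k<n. 1 + t * p ^ (n + k)) = (\<Prod>k<n. 1 + p ^ Suc k * exp Z)"
  proof (rule prod.cong, rule refl)
    fix k
    have "t * p ^ (n + k) = p ^ Suc k * exp Z"
      unfolding pk t_def by (simp add: algebra_simps flip: exp_add)
    then show "1 + t * p ^ (n + k) = 1 + p ^ Suc k * exp Z" by simp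
  qed
  finally have L: "M * ?L = (\<Prod>k<2 * n. 1 + t * p ^ k)" by (simp add: mult_ac)
  have "\<dots> = (\<Sum>j\<le>2 * n. gauss_binomial p (2 * n) j * p ^ (j choose 2) * t ^ j)"
    by (rule q_binomial_theorem[OF p])
  also have "\<dots> = (\<Sum>i\<in>{- int n..int n}. M * (gauss_binomial p (2 * n) (nat (int n + i))
       * exp (of_int i * (of_int i + 1) / 2 * P + of_int i * Z)))"
  proof (rule sum.reindex_bij_witness[of _ "\<lambda>i. nat (int n + i)" "\<lambda>j. int j - int n"])
    fix j assume j: "j \<in> {..2 * n}"
    define i where "i = int j - int n"
    have ci: "of_nat j = (of_int i + of_nat n :: complex)"
      by (simp add: i_def)
    have "p ^ (j choose 2) * t ^ j
       = exp (of_nat j * (of_nat j - 1) / 2 * P + of_nat j * (Z + (1 - of_nat n) * P))"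
      unfolding pk choose2 t_def by (simp add: exp_add exp_of_nat_mult)
    also have "of_nat j * (of_nat j - 1) / 2 * P + of_nat j * (Z + (1 - of_nat n) * P)
       = (of_nat n * Z - of_nat n * (of_nat n - 1) / 2 * P)
         + (of_int i * (of_int i + 1) / 2 * P + of_int i * Z)"
      unfolding ci by (simp add: field_simps)
    finally have "p ^ (j choose 2) * t ^ j = M * exp (of_int i * (of_int i + 1) / 2 * P + of_int i * Z)"
      by (simp add: M_def exp_add)
    then show "M * (gauss_binomial p (2 * n) (nat (int n + (int j - int n)))
       * exp (of_int (int j - int n) * (of_int (int j - int n) + 1) / 2 * P + of_int (int j - int n) * Z))
       = gauss_binomial p (2 * n) j * p ^ (j choose 2) * t ^ j"
      by (simp add: i_def mult_ac)
  qed auto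
  also have "\<dots> = M * ?R"
    by (simp add: sum_distrib_left)
  finally show ?thesis
    using L M by simp
qed

lemma summable_on_int_nat_halves:
  fixes f :: "int \<Rightarrow> real"
  assumes "summable (\<lambda>n. f (int n))" "summable (\<lambda>n. f (- int n))" "\<And>n. f n \<ge> 0"
  shows "f summable_on UNIV"
proof -
  have "f summable_on range int"
    using assms by (subst summable_on_reindex) (auto simp: o_def summable_on_UNIV_nonneg_real_iff)
  moreover have "f summable_on range (\<lambda>n. - int n)"
    using assms by (subst summable_on_reindex) (auto simp: o_def summable_on_UNIV_nonneg_real_iff inj_def)
  moreover have "range int \<union> range (\<lambda>n. - int n) = UNIV"
    using int_cases2 by (auto simp: image_iff) (metis int_cases2)
  ultimately show ?thesis
    by (metis summable_on_union)
qed

text \<open>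
  Completing the square bounds the exponent by \<open>K - |n|\<close>, so a geometric series dominates.
\<close>
lemma summable_on_int_gaussian:
  fixes a b :: real
  assumes a: "a > 0"
  shows "(\<lambda>n::int. exp (- a * (of_int n)\<^sup>2 + b * of_int n)) summable_on UNIV"
proof -
  define K where "K = (\<bar>b\<bar> + 1)\<^sup>2 / (4 * a)"
  have geo: "summable (\<lambda>n. exp K * exp (- 1 :: real) ^ n)"
    by (intro summable_mult summable_geometric) simp
  have "(\<lambda>n::int. exp K * exp (- real_of_int \<bar>n\<bar>)) summable_on UNIV"
    by (rule summable_on_int_nat_halves)
       (use geo in \<open>simp_all add: exp_of_nat_mult[symmetric] mult.commute\<close>)
  then have "(\<lambda>n::int. norm (exp (- a * (of_int n)\<^sup>2 + b * of_int n))) summable_on UNIV"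
  proof (rule Infinite_Sum.abs_summable_on_comparison_test')
    fix n :: int
    define x where "x = real_of_int \<bar>n\<bar>"
    have bn: "b * of_int n \<le> \<bar>b\<bar> * x"
      unfolding x_def by (metis abs_ge_self abs_mult of_int_abs)
    have "0 \<le> (2 * a * x - (\<bar>b\<bar> + 1))\<^sup>2"
      by simp
    then have "4 * a * ((\<bar>b\<bar> + 1) * x) \<le> 4 * a * (a * x\<^sup>2) + (\<bar>b\<bar> + 1)\<^sup>2"
      by (simp add: power2_eq_square algebra_simps)
    then have "(\<bar>b\<bar> + 1) * x \<le> a * x\<^sup>2 + K"
      using a by (simp add: K_def field_simps)
    then have "- a * (of_int n)\<^sup>2 + b * of_int n \<le> K - x"
      using bn by (simp add: x_def algebra_simps)
    then have "exp (- a * (of_int n)\<^sup>2 + b * of_int n) \<le> exp (K - x)" by simp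
    then show "norm (exp (- a * (of_int n)\<^sup>2 + b * of_int n)) \<le> exp K * exp (- real_of_int \<bar>n\<bar>)"
      by (simp add: x_def exp_diff exp_minus field_simps)
  qed
  then show ?thesis by simp
qed

lemma summable_power_norm:
  fixes p :: complex
  assumes "norm p < 1"
  shows "summable (\<lambda>k. norm (p ^ Suc k * c))"
  using assms by (simp add: norm_mult norm_power summable_mult2 summable_mult)

lemma convergent_prod_one_plus_powers:
  fixes p :: complex
  assumes p: "norm p < 1"
  shows "convergent_prod (\<lambda>k. 1 + p ^ Suc k * c)"
proof -
  have "abs_convergent_prod (\<lambda>k. 1 + p ^ Suc k * c)"
    using summable_power_norm[OF p, of c] by (simp add: abs_convergent_prod_conv_summable)
  then show ?thesis
    by (rule abs_convergent_prod_imp_convergent_prod)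
qed

lemma tendsto_prod_powers:
  fixes p :: complex
  assumes p: "norm p < 1"
  shows "(\<lambda>n. \<Prod>k<n. 1 + p ^ Suc k * c) \<longlonglongrightarrow> (\<Prod>k. 1 + p ^ Suc k * c)"
  using convergent_prod_one_plus_powers[OF p, of c]
  by (intro has_prod_imp_tendsto' convergent_prod_has_prod)

lemma q_pochhammer_tendsto:
  assumes p: "norm p < 1"
  shows "q_pochhammer p \<longlonglongrightarrow> (\<Prod>k. 1 - p ^ Suc k)"
  using tendsto_prod_powers[OF p, of "-1"] by (simp add: q_pochhammer_def[abs_def])

lemma q_pochhammer_limit_nonzero:
  fixes p :: complex
  assumes p: "norm p < 1"
  shows "(\<Prod>k. 1 - p ^ Suc k) \<noteq> 0"
proof (rule prodinf_nonzero)
  show "convergent_prod (\<lambda>k. 1 - p ^ Suc k)"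
    using convergent_prod_one_plus_powers[OF p, of "-1"] by simp
  show "1 - p ^ Suc k \<noteq> 0" for k
    using power_neq_one[OF p, of k] by simp
qed

lemma gauss_binomial_bounded:
  assumes p: "norm p < 1"
  obtains B where "\<And>n j. norm (gauss_binomial p n j) \<le> B"
proof -
  have "Bseq (q_pochhammer p)"
    using q_pochhammer_tendsto[OF p] convergent_def convergent_imp_Bseq by blast
  then obtain U where U: "U > 0" "\<And>n. norm (q_pochhammer p n) \<le> U"
    unfolding Bseq_def by auto
  have "(\<lambda>n. inverse (q_pochhammer p n)) \<longlonglongrightarrow> inverse (\<Prod>k. 1 - p ^ Suc k)"
    by (intro tendsto_inverse q_pochhammer_tendsto q_pochhammer_limit_nonzero p)
  then have "Bseq (\<lambda>n. inverse (q_pochhammer p n))"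
    using convergent_def convergent_imp_Bseq by blast
  then obtain V where V: "V > 0" "\<And>n. norm (inverse (q_pochhammer p n)) \<le> V"
    unfolding Bseq_def by auto
  have "norm (gauss_binomial p n j) \<le> U * (V * V)" for n j
  proof (cases "j \<le> n")
    case True
    then have "gauss_binomial p n j = q_pochhammer p n * (inverse (q_pochhammer p j) * inverse (q_pochhammer p (n - j)))"
      by (simp add: gauss_binomial_def field_simps)
    then have "norm (gauss_binomial p n j)
        = norm (q_pochhammer p n) * (norm (inverse (q_pochhammer p j)) * norm (inverse (q_pochhammer p (n - j))))"
      by (simp only: norm_mult)
    also have "\<dots> \<le> U * (V * V)"
      using U V by (intro mult_mono) (auto intro: less_imp_le)
    finally show ?thesis .
  next
    case False
    then show ?thesis using U V by (simp add: gauss_binomial_def)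
  qed
  then show ?thesis by (rule that)
qed

text \<open>
  Near the middle of the row all three Pochhammer symbols have the same limit \<open>Q\<close>, and the
  coefficient tends to \<open>Q / (Q \<cdot> Q)\<close>.
\<close>
lemma gauss_binomial_central_tendsto:
  assumes p: "norm p < 1"
  shows "(\<lambda>n. gauss_binomial p (2 * n) (nat (int n + i))) \<longlonglongrightarrow> inverse (\<Prod>k. 1 - p ^ Suc k)"
proof -
  define Q where "Q = (\<Prod>k. 1 - p ^ Suc k)"
  have Q: "Q \<noteq> 0"
    using q_pochhammer_limit_nonzero[OF p] by (simp add: Q_def)
  have sub: "(\<lambda>n. q_pochhammer p (g n)) \<longlonglongrightarrow> Q" if "filterlim g at_top sequentially" for g
    using filterlim_compose[OF q_pochhammer_tendsto[OF p] that] by (simp add: Q_def)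
  have nat_lim: "filterlim (\<lambda>n. nat (int n + j)) at_top sequentially" for j :: int
    unfolding filterlim_at_top
  proof
    fix Z :: nat
    show "\<forall>\<^sub>F n in sequentially. Z \<le> nat (int n + j)"
      using eventually_ge_at_top[of "Z + nat \<bar>j\<bar>"] by eventually_elim linarith
  qed
  have lim2: "filterlim (\<lambda>n. 2 * n :: nat) at_top sequentially"
    by (rule filterlim_subseq) (simp add: strict_mono_def)
  have "(\<lambda>n. q_pochhammer p (2 * n) / (q_pochhammer p (nat (int n + i)) * q_pochhammer p (nat (int n + (- i)))))
      \<longlonglongrightarrow> Q / (Q * Q)"
    using Q by (intro tendsto_divide tendsto_mult sub nat_lim lim2) auto
  also have "Q / (Q * Q) = inverse Q"
    using Q by (simp add: field_simps)
  finally have L: "(\<lambda>n. q_pochhammer p (2 * n) / (q_pochhammer p (nat (int n + i)) * q_pochhammer p (nat (int n + (- i)))))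
      \<longlonglongrightarrow> inverse Q" .
  have "\<forall>\<^sub>F n in sequentially.
      q_pochhammer p (2 * n) / (q_pochhammer p (nat (int n + i)) * q_pochhammer p (nat (int n + (- i))))
        = gauss_binomial p (2 * n) (nat (int n + i))"
    using eventually_ge_at_top[of "nat \<bar>i\<bar>"]
  proof eventually_elim
    case (elim n)
    then have "nat (int n + i) \<le> 2 * n" "2 * n - nat (int n + i) = nat (int n + (- i))"
      by linarith+
    then show ?case by (simp add: gauss_binomial_def)
  qed
  then show ?thesis
    using L tendsto_cong unfolding Q_def by fastforce
qed

text \<open>
  Dominated convergence for sums over the integers, by transport along \<open>int_decode\<close>.
  The summands enter twice, as \<open>a i n\<close> and \<open>a' n i\<close>, so that either may be viewed as a function of
  its last argument.
\<close>
lemma Tannery_has_sum_int: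
  fixes a :: "int \<Rightarrow> nat \<Rightarrow> complex"
  assumes lim: "\<And>i. a i \<longlonglongrightarrow> b i"
    and bound: "\<And>i n. norm (a i n) \<le> M i"
    and M: "M summable_on UNIV"
    and sum: "\<And>n. (a' n has_sum s n) UNIV" "\<And>n i. a' n i = a i n"
    and s: "s \<longlonglongrightarrow> S"
  shows "(b has_sum S) UNIV"
proof -
  have bij: "bij_betw int_decode UNIV UNIV"
    using bij_int_decode by simp
  have M0: "M i \<ge> 0" for i
    using bound[of i 0] norm_ge_zero order_trans by blast
  have "(\<lambda>k. M (int_decode k)) summable_on UNIV"
    using M summable_on_reindex_bij_betw[OF bij, of M] by simp
  then have sM: "summable (\<lambda>k. M (int_decode k))"
    by (simp add: summable_on_UNIV_nonneg_real_iff M0)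
  have ev: "eventually (\<lambda>(k, n). norm (a (int_decode k) n) \<le> M (int_decode k)) (at_top \<times>\<^sub>F sequentially)"
    by (rule always_eventually) (auto intro: bound)
  have T: "summable (\<lambda>k. norm (b (int_decode k)))"
    "(\<lambda>n. \<Sum>k. a (int_decode k) n) \<longlonglongrightarrow> (\<Sum>k. b (int_decode k))"
    using tannerys_theorem[of "\<lambda>k. a (int_decode k)" "\<lambda>k. b (int_decode k)" sequentially
        "\<lambda>k. M (int_decode k)", OF lim ev sM] by auto
  have "(\<lambda>k. a (int_decode k) n) sums s n" for n
  proof (rule has_sum_imp_sums)
    show "((\<lambda>k. a (int_decode k) n) has_sum s n) UNIV"
      using sum(1)[of n] has_sum_reindex_bij_betw[OF bij, of "a' n" "s n"] by (simp add: sum(2))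
  qed
  then have "(\<Sum>k. a (int_decode k) n) = s n" for n
    by (simp add: sums_iff)
  then have "(\<Sum>k. b (int_decode k)) = S"
    using T(2) s LIMSEQ_unique by auto
  then have "((\<lambda>k. b (int_decode k)) has_sum S) UNIV"
    using T(1) by (intro norm_summable_imp_has_sum) (auto simp: summable_norm_cancel sums_iff)
  then show ?thesis
    using has_sum_reindex_bij_betw[OF bij, of b S] by simp
qed

text \<open>
  Let \<open>n\<close> tend to infinity in the finite form.  The coefficients are uniformly bounded and the
  exponentials decay like a Gaussian, so the limit may be taken term by term.
\<close>
theorem Jacobi_triple_product:
  fixes P Z :: complex
  assumes P: "Re P < 0"
  defines "p \<equiv> exp P"
  shows "((\<lambda>i. exp (of_int i * (of_int i + 1) / 2 * P + of_int i * Z)) has_sum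
     (\<Prod>k. 1 - p ^ Suc k) * (1 + exp (- Z))
       * ((\<Prod>k. 1 + p ^ Suc k * exp (- Z)) * (\<Prod>k. 1 + p ^ Suc k * exp Z))) UNIV"
proof -
  have p: "norm p < 1"
    using P by (simp add: p_def)
  define Q where "Q = (\<Prod>k. 1 - p ^ Suc k)"
  have Q: "Q \<noteq> 0"
    using q_pochhammer_limit_nonzero[OF p] by (simp add: Q_def)
  define f where "f i = exp (of_int i * (of_int i + 1) / 2 * P + of_int i * Z)" for i :: int
  \<comment> \<open>the coefficients of the finite form, extended by zero to all integers\<close>
  define q where "q n i = (if i \<in> {- int n..int n} then gauss_binomial p (2 * n) (nat (int n + i)) else 0)" for n i
  obtain B where B: "\<And>n j. norm (gauss_binomial p n j) \<le> B"
    using gauss_binomial_bounded[OF p] by blast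
  have B0: "B \<ge> 0"
    using B[of 0 0] norm_ge_zero order_trans by blast
  define S where "S = (1 + exp (- Z)) * (\<Prod>k. 1 + p ^ Suc k * exp (- Z)) * (\<Prod>k. 1 + p ^ Suc k * exp Z)"
  have "((\<lambda>i. inverse Q * f i) has_sum S) UNIV"
  proof (rule Tannery_has_sum_int[where a = "\<lambda>i n. q n i * f i" and a' = "\<lambda>n i. q n i * f i"
        and M = "\<lambda>i. B * norm (f i)"
        and s = "\<lambda>n. (\<Prod>k<n. 1 + p ^ k * exp (- Z)) * (\<Prod>k<n. 1 + p ^ Suc k * exp Z)"])
    show "(\<lambda>n. q n i * f i) \<longlonglongrightarrow> inverse Q * f i" for i
    proof (intro tendsto_mult tendsto_const)
      have "\<forall>\<^sub>F n in sequentially. gauss_binomial p (2 * n) (nat (int n + i)) = q n i"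
        using eventually_ge_at_top[of "nat \<bar>i\<bar>"]
        by eventually_elim (auto simp: q_def)
      then show "(\<lambda>n. q n i) \<longlonglongrightarrow> inverse Q"
        using gauss_binomial_central_tendsto[OF p, of i] tendsto_cong unfolding Q_def by fastforce
    qed
    show "norm (q n i * f i) \<le> B * norm (f i)" for n i
      using B B0 by (auto simp: q_def norm_mult mult_right_mono)
    have "norm (f i) = exp (- (- Re P / 2) * (of_int i)\<^sup>2 + (Re P / 2 + Re Z) * of_int i)" for i
      by (simp add: f_def power2_eq_square algebra_simps)
    then have "(\<lambda>i. norm (f i)) summable_on UNIV"
      using summable_on_int_gaussian[of "- Re P / 2" "Re P / 2 + Re Z"] P by simp
    then show "(\<lambda>i. B * norm (f i)) summable_on UNIV"
      by (rule summable_on_cmult_right)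
    show "((\<lambda>i. q n i * f i) has_sum
        (\<Prod>k<n. 1 + p ^ k * exp (- Z)) * (\<Prod>k<n. 1 + p ^ Suc k * exp Z)) UNIV" for n
    proof -
      have "((\<lambda>i. q n i * f i) has_sum (\<Sum>i\<in>{- int n..int n}. q n i * f i)) {- int n..int n}"
        by (rule has_sum_finite) simp
      moreover have "(\<Sum>i\<in>{- int n..int n}. q n i * f i)
          = (\<Prod>k<n. 1 + p ^ k * exp (- Z)) * (\<Prod>k<n. 1 + p ^ Suc k * exp Z)"
        using finite_Jacobi_triple_product[OF P, where n = n and Z = Z] by (simp add: p_def q_def f_def)
      ultimately show ?thesis
        by (subst has_sum_cong_neutral[where S = UNIV and T = "{- int n..int n}"
              and g = "\<lambda>i. q n i * f i"]) (auto simp: q_def)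
    qed
    show "(\<lambda>n. (\<Prod>k<n. 1 + p ^ k * exp (- Z)) * (\<Prod>k<n. 1 + p ^ Suc k * exp Z)) \<longlonglongrightarrow> S"
      unfolding S_def
    proof (intro tendsto_mult tendsto_prod_powers p)
      have "(\<lambda>n. \<Prod>k<Suc n. 1 + p ^ k * exp (- Z))
         \<longlonglongrightarrow> (1 + exp (- Z)) * (\<Prod>k. 1 + p ^ Suc k * exp (- Z))"
        unfolding prod.lessThan_Suc_shift using tendsto_prod_powers[OF p, of "exp (- Z)"]
        by (intro tendsto_mult) auto
      then show "(\<lambda>n. \<Prod>k<n. 1 + p ^ k * exp (- Z))
         \<longlonglongrightarrow> (1 + exp (- Z)) * (\<Prod>k. 1 + p ^ Suc k * exp (- Z))"
        by (rule LIMSEQ_imp_Suc)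
    qed
  qed simp
  then have "((\<lambda>i. Q * (inverse Q * f i)) has_sum Q * S) UNIV"
    by (rule has_sum_cmult_right)
  moreover have "(\<lambda>i. Q * (inverse Q * f i)) = f"
    using Q by (simp add: fun_eq_iff)
  moreover have "Q * S = Q * (1 + exp (- Z))
       * ((\<Prod>k. 1 + p ^ Suc k * exp (- Z)) * (\<Prod>k. 1 + p ^ Suc k * exp Z))"
    by (simp only: S_def mult_ac)
  ultimately show ?thesis
    by (simp only: f_def[abs_def] Q_def)
qed

section \<open>Series and zeros of the theta functions\<close>

lemma theta_product_factor:
  "1 - 2 * p ^ Suc n * cos (2 * of_real pi * u) + p ^ (2 * Suc n)
     = (1 + p ^ Suc n * - exp (- (2 * of_real pi * \<i> * u)))
       * (1 + p ^ Suc n * - exp (2 * of_real pi * \<i> * u))"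
proof -
  have c: "2 * cos (2 * of_real pi * u)
      = exp (2 * of_real pi * \<i> * u) + exp (- (2 * of_real pi * \<i> * u))"
    by (simp add: cos_exp_eq mult_ac)
  have e: "exp (- (2 * of_real pi * \<i> * u)) * exp (2 * of_real pi * \<i> * u) = 1"
    by (simp flip: exp_add)
  have "p ^ (2 * Suc n) = p ^ Suc n * p ^ Suc n * (exp (- (2 * of_real pi * \<i> * u)) * exp (2 * of_real pi * \<i> * u))"
    unfolding e by (simp only: mult_2 power_add mult_1_right)
  then have "1 - 2 * p ^ Suc n * cos (2 * of_real pi * u) + p ^ (2 * Suc n)
    = 1 - p ^ Suc n * (2 * cos (2 * of_real pi * u))
      + p ^ Suc n * p ^ Suc n * (exp (- (2 * of_real pi * \<i> * u)) * exp (2 * of_real pi * \<i> * u))"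
    by (simp only: mult_ac)
  also have "\<dots> = (1 + p ^ Suc n * - exp (- (2 * of_real pi * \<i> * u)))
       * (1 + p ^ Suc n * - exp (2 * of_real pi * \<i> * u))"
    unfolding c by (simp add: algebra_simps)
  finally show ?thesis .
qed

lemma theta1_factored:
  fixes \<tau> u :: complex
  assumes \<tau>: "Im \<tau> > 0"
  defines "p \<equiv> exp (2 * of_real pi * \<i> * \<tau>)"
  shows "theta1 u \<tau> = 2 * exp (2 * of_real pi * \<i> * \<tau> / 8) * (\<Prod>n. 1 - p ^ Suc n) * sin (of_real pi * u)
     * ((\<Prod>n. 1 + p ^ Suc n * - exp (- (2 * of_real pi * \<i> * u)))
       * (\<Prod>n. 1 + p ^ Suc n * - exp (2 * of_real pi * \<i> * u)))"
proof -
  have p: "norm p < 1"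
    using \<tau> by (simp add: p_def)
  show ?thesis
    unfolding theta1_def Let_def p_def[symmetric] theta_product_factor
    by (simp only: prodinf_mult[OF convergent_prod_one_plus_powers[OF p] convergent_prod_one_plus_powers[OF p]])
qed

text \<open>
  The triple product at \<open>e\<^sup>Z = -e\<^bsup>2\<pi>iu\<^esup>\<close>.  Its extra factor \<open>1 + e\<^bsup>-Z\<^esup>\<close> is the sine up to an exponential.
  Shifting the argument to \<open>u + 1/2\<close> hides the alternating sign of the usual series.
\<close>
lemma theta1_series:
  fixes \<tau> u :: complex
  assumes \<tau>: "Im \<tau> > 0"
  shows "((\<lambda>n. - exp (of_real pi * \<i> * \<tau> * (of_int n + 1/2)\<^sup>2
            + 2 * of_real pi * \<i> * (of_int n + 1/2) * (u + 1/2))) has_sum theta1 u \<tau>) UNIV"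
proof -
  define P where "P = 2 * of_real pi * \<i> * \<tau>"
  define Z where "Z = 2 * of_real pi * \<i> * u + of_real pi * \<i>"
  have P: "Re P < 0"
    using \<tau> by (simp add: P_def)
  have eZ: "exp Z = - exp (2 * of_real pi * \<i> * u)" "exp (- Z) = - exp (- (2 * of_real pi * \<i> * u))"
    by (simp_all add: Z_def exp_add exp_diff exp_minus)
  define A where "A = - exp (P / 8 + of_real pi * \<i> * (u + 1/2))"
  have hp: "exp (of_real pi * \<i> / 2) = \<i>"
    by (simp add: exp_eq_polar)
  have sine: "A * (1 + exp (- Z)) = 2 * exp (P / 8) * sin (of_real pi * u)"
  proof -
    have "exp (of_real pi * \<i> * (u + 1/2)) = \<i> * exp (of_real pi * \<i> * u)"
      using hp by (simp add: exp_add algebra_simps)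
    moreover have "exp (of_real pi * \<i> * u) * exp (- (2 * of_real pi * \<i> * u)) = exp (- (of_real pi * \<i> * u))"
      unfolding exp_add[symmetric] by (rule arg_cong[where f = exp]) simp
    moreover have "sin (of_real pi * u) = (exp (of_real pi * \<i> * u) - exp (- (of_real pi * \<i> * u))) / (2 * \<i>)"
      by (simp add: sin_exp_eq mult_ac)
    moreover define E F G where "E = exp (of_real pi * \<i> * u)"
      and "F = exp (- (2 * of_real pi * \<i> * u))" and "G = exp (- (of_real pi * \<i> * u))"
    ultimately have *: "exp (of_real pi * \<i> * (u + 1/2)) = \<i> * E" "E * F = G"
      "sin (of_real pi * u) = (E - G) / (2 * \<i>)"
      by simp_all
    have "A * (1 + exp (- Z)) = - \<i> * exp (P / 8) * (E - E * F)"
      unfolding A_def eZ exp_add F_def[symmetric] *(1) by (simp add: algebra_simps)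
    also have "\<dots> = 2 * exp (P / 8) * sin (of_real pi * u)"
      unfolding *(2,3) by (simp add: field_simps)
    finally show ?thesis .
  qed
  have "((\<lambda>i. A * exp (of_int i * (of_int i + 1) / 2 * P + of_int i * Z)) has_sum
     A * ((\<Prod>k. 1 - exp P ^ Suc k) * (1 + exp (- Z))
       * ((\<Prod>k. 1 + exp P ^ Suc k * exp (- Z)) * (\<Prod>k. 1 + exp P ^ Suc k * exp Z)))) UNIV"
    by (intro has_sum_cmult_right Jacobi_triple_product P)
  also have "A * ((\<Prod>k. 1 - exp P ^ Suc k) * (1 + exp (- Z))
       * ((\<Prod>k. 1 + exp P ^ Suc k * exp (- Z)) * (\<Prod>k. 1 + exp P ^ Suc k * exp Z)))
     = (A * (1 + exp (- Z))) * (\<Prod>k. 1 - exp P ^ Suc k)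
       * ((\<Prod>k. 1 + exp P ^ Suc k * exp (- Z)) * (\<Prod>k. 1 + exp P ^ Suc k * exp Z))"
    by (simp only: mult_ac)
  also have "\<dots> = theta1 u \<tau>"
    unfolding sine unfolding theta1_factored[OF \<tau>] eZ P_def by (simp only: mult_ac)
  also have "(\<lambda>i. A * exp (of_int i * (of_int i + 1) / 2 * P + of_int i * Z))
     = (\<lambda>n. - exp (of_real pi * \<i> * \<tau> * (of_int n + 1/2)\<^sup>2
            + 2 * of_real pi * \<i> * (of_int n + 1/2) * (u + 1/2)))"
    unfolding A_def mult_minus_left exp_add[symmetric]
    by (rule ext, rule arg_cong[where f = "\<lambda>x. - exp x"])
       (simp add: P_def Z_def power2_eq_square field_simps)
  finally show ?thesis .
qed

text \<open>
  The shift of the argument by \<open>(\<sigma>+1)/2\<close> turns the half-integers in the series of \<open>\<vartheta>\<^sub>1\<close> into integers.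
\<close>
lemma theta3_series:
  fixes \<sigma> v :: complex
  assumes \<sigma>: "Im \<sigma> > 0"
  shows "((\<lambda>n. exp (of_real pi * \<i> * (\<sigma> * (of_int n)\<^sup>2 + 2 * of_int n * v))) has_sum theta3 v \<sigma>) UNIV"
proof -
  let ?g = "\<lambda>n::int. exp (of_real pi * \<i> * (\<sigma> * (of_int n)\<^sup>2 + 2 * of_int n * v))"
  have "((\<lambda>n. exp (of_real pi * \<i> * (v + \<sigma> / 4)) * - exp (of_real pi * \<i> * \<sigma> * (of_int n + 1/2)\<^sup>2
      + 2 * of_real pi * \<i> * (of_int n + 1/2) * ((v + (\<sigma> + 1) / 2) + 1/2))) has_sum theta3 v \<sigma>) UNIV"
    unfolding theta3_def by (intro has_sum_cmult_right theta1_series \<sigma>)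
  also have "(\<lambda>n. exp (of_real pi * \<i> * (v + \<sigma> / 4)) * - exp (of_real pi * \<i> * \<sigma> * (of_int n + 1/2)\<^sup>2
      + 2 * of_real pi * \<i> * (of_int n + 1/2) * ((v + (\<sigma> + 1) / 2) + 1/2))) = (\<lambda>n. ?g (n + 1))"
  proof
    fix n :: int
    have "of_real pi * \<i> * (v + \<sigma> / 4) + (of_real pi * \<i> * \<sigma> * (of_int n + 1/2)\<^sup>2
      + 2 * of_real pi * \<i> * (of_int n + 1/2) * ((v + (\<sigma> + 1) / 2) + 1/2))
      = of_real pi * \<i> * (\<sigma> * (of_int (n + 1))\<^sup>2 + 2 * of_int (n + 1) * v)
        + (2 * of_int n * of_real pi * \<i> + of_real pi * \<i>)"
      by (simp add: power2_eq_square field_simps)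
    moreover have "exp (2 * of_int n * of_real pi * \<i> + of_real pi * \<i>) = -1"
      using exp_integer_2pi[of "of_int n"] by (simp add: exp_add mult_ac)
    ultimately show "exp (of_real pi * \<i> * (v + \<sigma> / 4)) * - exp (of_real pi * \<i> * \<sigma> * (of_int n + 1/2)\<^sup>2
      + 2 * of_real pi * \<i> * (of_int n + 1/2) * ((v + (\<sigma> + 1) / 2) + 1/2)) = ?g (n + 1)"
      by (simp only: mult_minus_right exp_add[symmetric]) (simp only: exp_add, simp)
  qed
  finally show ?thesis
    using has_sum_reindex_bij_betw[of "\<lambda>n. n + 1" UNIV UNIV ?g] bij_plus_right[of "1::int"] by simp
qed

lemma theta1_plus_1: "theta1 (u + 1) \<tau> = - theta1 u \<tau>"
proof -
  have "sin (of_real pi * (u + 1)) = - sin (of_real pi * u)"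
    by (simp add: distrib_left sin_add)
  moreover have "cos (2 * of_real pi * (u + 1)) = cos (2 * of_real pi * u)"
    by (simp add: distrib_left cos_add)
  ultimately show ?thesis
    by (simp add: theta1_def Let_def)
qed

lemma theta0_eq_theta3_shift: "theta0 v \<sigma> = theta3 (v + 1/2) \<sigma>"
proof -
  have "theta1 (v + \<sigma> / 2 + 1) \<sigma> = - theta1 (v + \<sigma> / 2) \<sigma>"
    by (rule theta1_plus_1)
  moreover have "v + 1/2 + (\<sigma> + 1) / 2 = v + \<sigma> / 2 + 1"
    by (simp add: field_simps)
  moreover have "exp (of_real pi * \<i> * (v + 1/2 + \<sigma> / 4)) = \<i> * exp (of_real pi * \<i> * (v + \<sigma> / 4))"
  proof -
    have "exp (of_real pi * \<i> / 2) = \<i>"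
    by (simp add: exp_eq_polar)
    moreover have "of_real pi * \<i> * (v + 1/2 + \<sigma> / 4) = of_real pi * \<i> / 2 + of_real pi * \<i> * (v + \<sigma> / 4)"
      by (simp add: field_simps)
    ultimately show ?thesis by (simp only: exp_add)
  qed
  ultimately have "theta3 (v + 1/2) \<sigma>
      = \<i> * exp (of_real pi * \<i> * (v + \<sigma> / 4)) * - theta1 (v + \<sigma> / 2) \<sigma>"
    by (simp only: theta3_def)
  then show ?thesis
    by (simp add: theta0_def)
qed

text \<open>
  A convergent product vanishes only if one of its factors does.  For \<open>n \<ge> 1\<close> such a zero means
  \<open>\<plusminus>u + n\<tau> \<in> \<int>\<close>, and the sine contributes the integers.
\<close>
lemma theta1_nonzero:
  assumes \<tau>: "Im \<tau> > 0" and u: "u \<notin> period_lattice \<tau>"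
  shows "theta1 u \<tau> \<noteq> 0"
proof -
  define p where "p = exp (2 * of_real pi * \<i> * \<tau>)"
  have p: "norm p < 1"
    using \<tau> by (simp add: p_def)
  have key: "exp (2 * of_real pi * \<i> * (of_int s * u + of_int t * \<tau>)) \<noteq> 1" if "s = 1 \<or> s = -1" for s t :: int
  proof
    assume "exp (2 * of_real pi * \<i> * (of_int s * u + of_int t * \<tau>)) = 1"
    then obtain m :: int where "2 * of_real pi * \<i> * (of_int s * u + of_int t * \<tau>) = of_int (2 * m) * pi * \<i>"
      unfolding exp_eq_1 by (auto simp: complex_eq_iff)
    then have "of_int s * u + of_int t * \<tau> = of_int m"
      by simp
    then have "u = of_int (s * m) + of_int (- s * t) * \<tau>"
      using that by (auto simp: algebra_simps add_eq_0_iff)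
    then show False
      using u unfolding period_lattice_def by blast
  qed
  have nz: "1 + p ^ Suc n * - exp (- (2 * of_real pi * \<i> * u)) \<noteq> 0"
    "1 + p ^ Suc n * - exp (2 * of_real pi * \<i> * u) \<noteq> 0" for n
  proof -
    have pn: "p ^ Suc n = exp (2 * of_real pi * \<i> * (of_int (int (Suc n)) * \<tau>))"
      unfolding p_def exp_of_nat_mult[symmetric] by (simp add: mult_ac)
    show "1 + p ^ Suc n * - exp (- (2 * of_real pi * \<i> * u)) \<noteq> 0"
      using key[of "-1" "int (Suc n)"] unfolding pn mult_minus_right exp_add[symmetric]
      by (simp add: algebra_simps)
    show "1 + p ^ Suc n * - exp (2 * of_real pi * \<i> * u) \<noteq> 0"
      using key[of 1 "int (Suc n)"] unfolding pn mult_minus_right exp_add[symmetric]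
      by (simp add: algebra_simps)
  qed
  have "sin (of_real pi * u) \<noteq> 0"
  proof
    assume "sin (of_real pi * u) = 0"
    then obtain m :: int where "of_real pi * u = of_real (of_int m * pi)"
      by (auto simp: sin_eq_0)
    then have "u = of_int m + of_int 0 * \<tau>"
      by (simp add: mult.commute)
    then show False
      using u unfolding period_lattice_def by blast
  qed
  then show ?thesis
    unfolding theta1_factored[OF \<tau>] p_def[symmetric]
    using q_pochhammer_limit_nonzero[OF p] prodinf_nonzero[OF convergent_prod_one_plus_powers[OF p] nz(1)]
      prodinf_nonzero[OF convergent_prod_one_plus_powers[OF p] nz(2)]
    by simp
qed

section \<open>The addition formula\<close>

lemma has_sum_Times_complex:
  fixes f :: "'a \<Rightarrow> complex" and g :: "'b \<Rightarrow> complex"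
  assumes f: "(f has_sum F) A" and g: "(g has_sum G) B"
  shows "((\<lambda>(i, j). f i * g j) has_sum F * G) (A \<times> B)"
proof (rule has_sum_SigmaI[where g = "\<lambda>i. f i * G"])
  show "((\<lambda>j. case (i, j) of (i, j) \<Rightarrow> f i * g j) has_sum f i * G) B" for i
    using has_sum_cmult_right[OF g] by simp
  show "((\<lambda>i. f i * G) has_sum F * G) A"
    by (rule has_sum_cmult_left[OF f])
  have af: "(\<lambda>i. norm (f i)) summable_on A" and ag: "(\<lambda>j. norm (g j)) summable_on B"
    using f g has_sum_imp_summable summable_on_iff_abs_summable_on_complex by blast+
  have "(\<lambda>z. norm (case z of (i, j) \<Rightarrow> f i * g j)) summable_on A \<times> B"
    unfolding Infinite_Sum.abs_summable_on_Sigma_iff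
  proof (intro conjI ballI)
    show "(\<lambda>j. norm (case (i, j) of (i, j) \<Rightarrow> f i * g j)) summable_on B" for i
      using summable_on_cmult_right[OF ag, of "norm (f i)"] by (simp add: norm_mult)
    show "(\<lambda>i. norm (\<Sum>\<^sub>\<infinity>j\<in>B. norm (case (i, j) of (i, j) \<Rightarrow> f i * g j))) summable_on A"
      using summable_on_cmult_left[OF af, of "\<bar>\<Sum>\<^sub>\<infinity>j\<in>B. norm (g j)\<bar>"]
      by (simp add: norm_mult infsum_cmult_right' abs_mult)
  qed
  then show "(\<lambda>(i, j). f i * g j) summable_on A \<times> B"
    by (rule abs_summable_summable)
qed

lemma exp_pi_i_int: "exp (of_real pi * \<i> * of_int m) = (if even m then 1 else - 1)"
proof (cases "even m")
  case True
  then obtain k where "m = 2 * k" by blast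
  then show ?thesis
    using exp_integer_2pi[of "of_int k"] by (simp add: mult_ac)
next
  case False
  then obtain k where "m = 2 * k + 1" by (blast elim: oddE)
  then show ?thesis
    using exp_integer_2pi[of "of_int k"] by (simp add: exp_add ring_distribs mult_ac)
qed

text \<open>
  Multiply the series.  The left-hand side becomes a sum over pairs \<open>(m, n)\<close> with the coefficient
  \<open>(-1)\<^sup>m - (-1)\<^sup>n\<close>, so only pairs with \<open>m + n\<close> odd survive, and there the coefficient is \<open>2 (-1)\<^sup>m\<close>.
  These pairs are exactly \<open>m = j + l + 1\<close>, \<open>n = j - l\<close>, and since
  \<open>m\<^sup>2 + n\<^sup>2 = 2 (j + 1/2)\<^sup>2 + 2 (l + 1/2)\<^sup>2\<close> the sum separates into the two series of \<open>\<vartheta>\<^sub>1\<close> at parameter \<open>\<tau>\<close>.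
\<close>
theorem theta_addition:
  fixes \<tau> x y :: complex
  assumes \<tau>: "Im \<tau> > 0"
  shows "theta0 x (\<tau> / 2) * theta3 y (\<tau> / 2) - theta3 x (\<tau> / 2) * theta0 y (\<tau> / 2)
     = 2 * (theta1 (x + y) \<tau> * theta1 (x - y) \<tau>)"
proof -
  have \<sigma>: "Im (\<tau> / 2) > 0" using \<tau> by simp
  define t where "t m v = exp (of_real pi * \<i> * (\<tau> / 2 * (of_int m)\<^sup>2 + 2 * of_int m * v))" for m :: int and v
  define s where "s n v = - exp (of_real pi * \<i> * \<tau> * (of_int n + 1/2)\<^sup>2
            + 2 * of_real pi * \<i> * (of_int n + 1/2) * (v + 1/2))" for n :: int and v
  define e where "e m = (if even m then 1 else - 1 :: complex)" for m :: int
  define D where "D = (\<lambda>(m, n). (e m - e n) * (t m x * t n y))"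
  have th3: "((\<lambda>m. t m v) has_sum theta3 v (\<tau> / 2)) UNIV" for v
    unfolding t_def by (rule theta3_series[OF \<sigma>])
  have "t m (v + 1/2) = e m * t m v" for m v
    unfolding t_def e_def exp_pi_i_int[symmetric] exp_add[symmetric]
    by (rule arg_cong[where f = exp]) (simp add: algebra_simps)
  then have th0: "((\<lambda>m. e m * t m v) has_sum theta0 v (\<tau> / 2)) UNIV" for v
    using th3[of "v + 1/2"] by (simp add: theta0_eq_theta3_shift)
  have "((\<lambda>z. (case z of (m, n) \<Rightarrow> e m * t m x * t n y) + - (case z of (m, n) \<Rightarrow> t m x * (e n * t n y)))
      has_sum theta0 x (\<tau> / 2) * theta3 y (\<tau> / 2) + - (theta3 x (\<tau> / 2) * theta0 y (\<tau> / 2))) (UNIV \<times> UNIV)"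
    by (intro has_sum_add has_sum_uminusI has_sum_Times_complex th0 th3)
  also have "(\<lambda>z. (case z of (m, n) \<Rightarrow> e m * t m x * t n y) + - (case z of (m, n) \<Rightarrow> t m x * (e n * t n y))) = D"
    by (auto simp: fun_eq_iff D_def algebra_simps)
  also have "(D has_sum S) (UNIV \<times> UNIV) \<longleftrightarrow> (D has_sum S) {(m, n). odd (m + n)}" for S
    by (rule has_sum_cong_neutral) (auto simp: D_def e_def split: if_splits)
  also have "(D has_sum S) {(m, n). odd (m + n)}
      \<longleftrightarrow> ((\<lambda>z. 2 * (case z of (j, l) \<Rightarrow> s j (x + y) * s l (x - y))) has_sum S) (UNIV \<times> UNIV)" for S
  proof (rule sym, rule has_sum_reindex_bij_witness[where j = "\<lambda>(j, l). (j + l + 1, j - l)"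
        and i = "\<lambda>(m, n). ((m + n - 1) div 2, (m - n - 1) div 2)"])
    fix z :: "int \<times> int"
    obtain j l where z: "z = (j, l)" by (cases z)
    have "e (j - l) = - e (j + l + 1)"
      by (auto simp: e_def)
    then have "D (j + l + 1, j - l) = 2 * (e (j + l + 1) * t (j + l + 1) x * t (j - l) y)"
      by (simp add: D_def)
    also have "e (j + l + 1) * t (j + l + 1) x * t (j - l) y = s j (x + y) * s l (x - y)"
      unfolding e_def exp_pi_i_int[symmetric] t_def s_def minus_mult_minus exp_add[symmetric]
      by (rule arg_cong[where f = exp]) (simp add: power2_eq_square field_simps)
    finally show "D (case z of (j, l) \<Rightarrow> (j + l + 1, j - l)) = 2 * (case z of (j, l) \<Rightarrow> s j (x + y) * s l (x - y))"
      by (simp add: z)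
  next
    fix z :: "int \<times> int"
    assume "z \<in> {(m, n). odd (m + n)}"
    then obtain m n where z: "z = (m, n)" and "odd (m + n)"
      by blast
    then obtain k where k: "m + n = 2 * k + 1"
      by (blast elim: oddE)
    have "(m + n - 1) div 2 = k" "(m - n - 1) div 2 = k - n"
      using k by linarith+
    then show "(case (case z of (m, n) \<Rightarrow> ((m + n - 1) div 2, (m - n - 1) div 2)) of
        (j, l) \<Rightarrow> (j + l + 1, j - l)) = z"
      using k by (simp add: z)
  qed auto
  finally have "((\<lambda>z. 2 * (case z of (j, l) \<Rightarrow> s j (x + y) * s l (x - y)))
    has_sum theta0 x (\<tau> / 2) * theta3 y (\<tau> / 2) - theta3 x (\<tau> / 2) * theta0 y (\<tau> / 2)) (UNIV \<times> UNIV)"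
    by simp
  moreover have "((\<lambda>z. 2 * (case z of (j, l) \<Rightarrow> s j (x + y) * s l (x - y)))
    has_sum 2 * (theta1 (x + y) \<tau> * theta1 (x - y) \<tau>)) (UNIV \<times> UNIV)"
    unfolding s_def by (intro has_sum_cmult_right has_sum_Times_complex theta1_series \<tau>)
  ultimately show ?thesis
    by (rule has_sum_unique)
qed

section \<open>One step between neighbouring heights\<close>

lemma theta1_minus: "theta1 (- u) \<tau> = - theta1 u \<tau>"
  by (simp add: theta1_def Let_def)

lemma bracket_minus: "bracket \<tau> r (- u) = - bracket \<tau> r u"
  by (simp add: bracket_def theta1_minus)

lemma theta_const_nonzero: "\<tau> \<noteq> 0 \<Longrightarrow> theta_const \<tau> r \<noteq> 0"
  by (simp add: theta_const_def x_pow_def)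

lemma bracket_nonzero:
  assumes "Im \<tau> > 0" "u / r \<notin> period_lattice \<tau>"
  shows "bracket \<tau> r u \<noteq> 0"
proof -
  have "\<tau> \<noteq> 0" using assms(1) by auto
  then show ?thesis
    using theta1_nonzero[OF assms] theta_const_nonzero by (simp add: bracket_def)
qed

text \<open>
  The function \<open>\<vartheta>\<^sub>0\<close> or \<open>\<vartheta>\<^sub>3\<close> at parameter \<open>\<tau>/2\<close> that enters \<open>\<psi>\<^sub>\<epsilon>\<close>, as a function of a free argument.
\<close>
definition half_theta :: "complex \<Rightarrow> int \<Rightarrow> complex \<Rightarrow> complex" where
  "half_theta \<tau> \<epsilon> v = (if \<epsilon> = 1 then theta0 v (\<tau> / 2) else theta3 v (\<tau> / 2))"

definition theta_det :: "complex \<Rightarrow> complex \<Rightarrow> complex \<Rightarrow> complex" where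
  "theta_det \<tau> v w = half_theta \<tau> 1 v * half_theta \<tau> (-1) w - half_theta \<tau> (-1) v * half_theta \<tau> 1 w"

lemma bracket_product:
  assumes "Im \<tau> > 0" "r \<noteq> 0"
  shows "bracket \<tau> r (r * (v + w)) * bracket \<tau> r (r * (v - w)) = (theta_const \<tau> r)\<^sup>2 / 2 * theta_det \<tau> v w"
  using assms theta_addition[OF assms(1), of v w]
  by (simp add: bracket_def theta_det_def half_theta_def power2_eq_square)

text \<open>
  The cofactor of \<open>\<psi>\<^sub>\<epsilon>\<close> when \<open>[y+rz][y-rz]\<close> is expanded as a determinant.
\<close>
definition spin_fun :: "complex \<Rightarrow> complex \<Rightarrow> int \<Rightarrow> complex \<Rightarrow> complex" where
  "spin_fun \<tau> r \<epsilon> z = of_int \<epsilon> * (theta_const \<tau> r)\<^sup>2 / 2 * half_theta \<tau> (- \<epsilon>) z"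

text \<open>
  The contribution of a step from height \<open>a\<close> to \<open>b\<close> to the natural basis.  For \<open>k = 1\<close> it is
  \<open>e\<^sub>0(z)\<close> if the step goes down and \<open>e\<^sub>1(z)\<close> if it goes up.
\<close>
definition step_fun :: "complex \<Rightarrow> complex \<Rightarrow> complex \<Rightarrow> int \<Rightarrow> int \<Rightarrow> complex \<Rightarrow> complex" where
  "step_fun \<tau> r u a b z = (let y = (of_int (a - b) * u + of_int a) / 2 in
     bracket \<tau> r (y + r * z) * bracket \<tau> r (y - r * z))"

lemma step_fun_eq_theta_det:
  assumes "Im \<tau> > 0" "r \<noteq> 0"
  shows "step_fun \<tau> r u a b z
     = (theta_const \<tau> r)\<^sup>2 / 2 * theta_det \<tau> ((of_int (a - b) * u + of_int a) / (2 * r)) z"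
proof -
  define v where "v = (of_int (a - b) * u + of_int a) / (2 * r)"
  have "(of_int (a - b) * u + of_int a) / 2 = r * v"
    using assms(2) by (simp add: v_def)
  then show ?thesis
    using bracket_product[OF assms, of v z]
    unfolding step_fun_def Let_def v_def[symmetric] by (simp add: ring_distribs)
qed

lemma step_fun_eq_sum_psi:
  assumes "Im \<tau> > 0" "r \<noteq> 0"
  shows "(\<Sum>\<epsilon>\<in>{-1, 1}. psi \<tau> r \<epsilon> u a b * spin_fun \<tau> r \<epsilon> z) = step_fun \<tau> r u a b z"
  unfolding step_fun_eq_theta_det[OF assms]
  by (simp add: psi_def Let_def spin_fun_def theta_det_def half_theta_def field_simps)

text \<open>
  Cramer's rule for the two determinants with arguments \<open>y\<^sub>s = (c+su)/(2r)\<close>, \<open>s = \<plusminus>1\<close>.  The system has the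
  determinant \<open>\<vartheta>\<^sub>0(y\<^sub>1) \<vartheta>\<^sub>3(y\<^sub>-) - \<vartheta>\<^sub>3(y\<^sub>1) \<vartheta>\<^sub>0(y\<^sub>-)\<close> with \<open>y\<^sub>-\<close> the argument for \<open>s = -1\<close>, and by the addition
  formula this is \<open>[c][u]\<close> up to a constant, because \<open>y\<^sub>1 + y\<^sub>- = c/r\<close> and \<open>y\<^sub>1 - y\<^sub>- = u/r\<close>.  This explains
  the denominator of \<open>\<psi>\<^sup>*\<close>.
\<close>
lemma spin_fun_eq_sum_psi_star:
  assumes \<tau>: "Im \<tau> > 0" and r: "r \<noteq> 0" and \<epsilon>: "\<epsilon> \<in> {-1, 1}"
    and nz: "bracket \<tau> r (of_int c) \<noteq> 0" "bracket \<tau> r u \<noteq> 0"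
  shows "(\<Sum>s\<in>{-1, 1}. psi_star \<tau> r \<epsilon> u (c + s) c * step_fun \<tau> r u c (c + s) z) = spin_fun \<tau> r \<epsilon> z"
proof -
  define y where "y s = (of_int c + of_int s * u) / (2 * r)" for s :: int
  define K where "K = (theta_const \<tau> r)\<^sup>2 / 2"
  define B where "B = bracket \<tau> r (of_int c) * bracket \<tau> r u"
  have B: "B = K * theta_det \<tau> (y 1) (y (-1))"
  proof -
    have "r * (y 1 + y (-1)) = of_int c" "r * (y 1 - y (-1)) = u"
      using r by (simp_all add: y_def field_simps)
    then show ?thesis
      using bracket_product[OF \<tau> r, of "y 1" "y (-1)"] by (simp add: B_def K_def)
  qed
  have B0: "B \<noteq> 0" using nz by (simp add: B_def)
  have st: "step_fun \<tau> r u c (c + s) z = K * theta_det \<tau> (y (- s)) z" for s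
    unfolding step_fun_eq_theta_det[OF \<tau> r] by (simp add: K_def y_def add.commute)
  have ps: "psi_star \<tau> r \<epsilon> u (c + s) c = - of_int \<epsilon> * of_int s * K / B * half_theta \<tau> (- \<epsilon>) (y s)" for s
    by (simp add: psi_star_def psi_def Let_def half_theta_def K_def B_def y_def algebra_simps)
  \<comment> \<open>Three vectors in a plane satisfy the Pluecker relation.\<close>
  have "theta_det \<tau> (y 1) (y (-1)) * half_theta \<tau> (- \<epsilon>) z
      = theta_det \<tau> (y 1) z * half_theta \<tau> (- \<epsilon>) (y (-1)) - theta_det \<tau> (y (-1)) z * half_theta \<tau> (- \<epsilon>) (y 1)"
    using \<epsilon> by (auto simp: theta_det_def algebra_simps)
  then have "K * K * (theta_det \<tau> (y 1) z * half_theta \<tau> (- \<epsilon>) (y (-1)) - theta_det \<tau> (y (-1)) z * half_theta \<tau> (- \<epsilon>) (y 1))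
      = B * (K * half_theta \<tau> (- \<epsilon>) z)"
    unfolding B by (simp only: mult_ac)
  moreover have "(\<Sum>s\<in>{-1, 1}. psi_star \<tau> r \<epsilon> u (c + s) c * step_fun \<tau> r u c (c + s) z)
     = of_int \<epsilon> / B * (K * K * (theta_det \<tau> (y 1) z * half_theta \<tau> (- \<epsilon>) (y (-1)) - theta_det \<tau> (y (-1)) z * half_theta \<tau> (- \<epsilon>) (y 1)))"
    unfolding st ps by (simp add: algebra_simps)
  ultimately show ?thesis
    using B0 by (simp add: spin_fun_def K_def)
qed

section \<open>Paths of heights\<close>

lemma bracket_poch_Suc:
  "bracket_poch \<tau> r v (Suc n) = bracket_poch \<tau> r v n * bracket \<tau> r (v + of_nat n)"
  by (simp add: bracket_poch_def)

text \<open>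
  After \<open>N\<close> steps, \<open>l\<close> of them up, the current height is \<open>h\<^sub>0 - N + 2l\<close> and the spectral parameter
  \<open>u+k-1-N\<close>.  Hence the argument \<open>y\<close> of the next factor is \<open>\<alpha> + l\<close> for an up step and
  \<open>-(\<beta> + N - l)\<close> for a down step, whatever the order of the earlier steps was.  The bracket being odd,
  the signs cancel in the second case.
\<close>
lemma path_product:
  fixes h :: "nat \<Rightarrow> int"
  assumes "\<forall>i<k. \<bar>h i - h (Suc i)\<bar> = 1" "N \<le> k"
    and \<alpha>: "\<alpha> = (- u + of_int (h 0) - of_nat k + 1) / 2"
    and \<beta>: "\<beta> = (- u - of_int (h 0) - of_nat k + 1) / 2"
  shows "\<exists>l\<le>N. h N = h 0 - int N + 2 * int l \<and>
    (\<Prod>i<N. step_fun \<tau> r (u + of_nat (k - 1 - i)) (h i) (h (Suc i)) z)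
      = bracket_poch \<tau> r (\<alpha> + r * z) l * bracket_poch \<tau> r (\<alpha> - r * z) l
        * bracket_poch \<tau> r (\<beta> + r * z) (N - l) * bracket_poch \<tau> r (\<beta> - r * z) (N - l)"
  using assms(2)
proof (induction N)
  case 0
  then show ?case by (simp add: bracket_poch_def)
next
  case (Suc N)
  then obtain l where l: "l \<le> N" "h N = h 0 - int N + 2 * int l"
    and IH: "(\<Prod>i<N. step_fun \<tau> r (u + of_nat (k - 1 - i)) (h i) (h (Suc i)) z)
      = bracket_poch \<tau> r (\<alpha> + r * z) l * bracket_poch \<tau> r (\<alpha> - r * z) l
        * bracket_poch \<tau> r (\<beta> + r * z) (N - l) * bracket_poch \<tau> r (\<beta> - r * z) (N - l)"
    by auto
  have hN: "of_int (h N) = (of_int (h 0) - of_nat N + 2 * of_nat l :: complex)"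
    unfolding l(2) by simp
  have kN: "(of_nat (k - 1 - N) :: complex) = of_nat k - 1 - of_nat N"
    using Suc.prems by (simp add: of_nat_diff)
  have "\<bar>h N - h (Suc N)\<bar> = 1"
    using assms(1) Suc.prems by simp
  then consider "h (Suc N) = h N + 1" | "h (Suc N) = h N - 1"
    by linarith
  then show ?case
  proof cases
    case 1
    have y: "(of_int (h N - h (Suc N)) * (u + of_nat (k - 1 - N)) + of_int (h N)) / 2 = \<alpha> + of_nat l"
      unfolding 1 kN hN \<alpha> by (simp add: field_simps)
    have st: "step_fun \<tau> r (u + of_nat (k - 1 - N)) (h N) (h (Suc N)) z
       = bracket \<tau> r (\<alpha> + r * z + of_nat l) * bracket \<tau> r (\<alpha> - r * z + of_nat l)"
      unfolding step_fun_def Let_def y by (simp add: add_ac add_diff_eq diff_add_eq)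
    show ?thesis
    proof (intro exI[of _ "Suc l"] conjI)
      show "h (Suc N) = h 0 - int (Suc N) + 2 * int (Suc l)"
        using l 1 by simp
      show "(\<Prod>i<Suc N. step_fun \<tau> r (u + of_nat (k - 1 - i)) (h i) (h (Suc i)) z)
          = bracket_poch \<tau> r (\<alpha> + r * z) (Suc l) * bracket_poch \<tau> r (\<alpha> - r * z) (Suc l)
            * bracket_poch \<tau> r (\<beta> + r * z) (Suc N - Suc l) * bracket_poch \<tau> r (\<beta> - r * z) (Suc N - Suc l)"
        unfolding prod.lessThan_Suc IH st bracket_poch_Suc diff_Suc_Suc by (simp only: mult_ac)
    qed (use l in simp)
  next
    case 2
    have dl: "(of_nat (N - l) :: complex) = of_nat N - of_nat l"
      using l by (simp add: of_nat_diff)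
    have "(of_int (h N - h (Suc N)) * (u + of_nat (k - 1 - N)) + of_int (h N)) / 2 = - (\<beta> + of_nat (N - l))"
      unfolding 2 kN hN \<beta> dl by (simp add: field_simps)
    moreover have "- (\<beta> + of_nat (N - l)) + r * z = - (\<beta> - r * z + of_nat (N - l))"
      "- (\<beta> + of_nat (N - l)) - r * z = - (\<beta> + r * z + of_nat (N - l))"
      by simp_all
    ultimately have st: "step_fun \<tau> r (u + of_nat (k - 1 - N)) (h N) (h (Suc N)) z
       = bracket \<tau> r (\<beta> + r * z + of_nat (N - l)) * bracket \<tau> r (\<beta> - r * z + of_nat (N - l))"
      unfolding step_fun_def Let_def by (simp only: bracket_minus) simp
    have d: "Suc N - l = Suc (N - l)" using l by simp
    show ?thesis
    proof (intro exI[of _ l] conjI)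
      show "h (Suc N) = h 0 - int (Suc N) + 2 * int l"
        using l 2 by simp
      show "(\<Prod>i<Suc N. step_fun \<tau> r (u + of_nat (k - 1 - i)) (h i) (h (Suc i)) z)
          = bracket_poch \<tau> r (\<alpha> + r * z) l * bracket_poch \<tau> r (\<alpha> - r * z) l
            * bracket_poch \<tau> r (\<beta> + r * z) (Suc N - l) * bracket_poch \<tau> r (\<beta> - r * z) (Suc N - l)"
        unfolding prod.lessThan_Suc IH st d bracket_poch_Suc by (simp only: mult_ac)
    qed (use l in simp)
  qed
qed

lemma path_product_nat_basis:
  assumes h: "h \<in> height_paths k a b" and ab: "a - b = int k - 2 * int n"
    and \<alpha>: "\<alpha> = (- u + of_int a - of_nat k + 1) / 2"
    and \<beta>: "\<beta> = (- u - of_int a - of_nat k + 1) / 2"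
  shows "(\<Prod>i<k. step_fun \<tau> r (u + of_nat (k - 1 - i)) (h i) (h (Suc i)) z) = nat_basis \<tau> r k n \<alpha> \<beta> z"
proof -
  have h': "h 0 = a" "h k = b" "\<forall>i<k. \<bar>h i - h (Suc i)\<bar> = 1"
    using h by (auto simp: height_paths_def)
  obtain l where "h k = h 0 - int k + 2 * int l"
    and "(\<Prod>i<k. step_fun \<tau> r (u + of_nat (k - 1 - i)) (h i) (h (Suc i)) z)
      = bracket_poch \<tau> r (\<alpha> + r * z) l * bracket_poch \<tau> r (\<alpha> - r * z) l
        * bracket_poch \<tau> r (\<beta> + r * z) (k - l) * bracket_poch \<tau> r (\<beta> - r * z) (k - l)"
    using path_product[OF h'(3) order_refl, of \<alpha> u \<beta>] \<alpha> \<beta> h'(1) by blast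
  moreover from this have "l = n"
    using ab h' by simp
  ultimately show ?thesis
    by (simp add: nat_basis_def)
qed

text \<open>
  Total sign and product over a sign sequence both depend only on the number \<open>j\<close> of plus signs.
\<close>
lemma sign_seq_count:
  fixes g :: "int \<Rightarrow> complex"
  assumes "\<forall>i<k. \<epsilon> i \<in> {-1, 1 :: int}"
  shows "\<exists>j\<le>k. (\<Sum>i<k. \<epsilon> i) = 2 * int j - int k \<and> (\<Prod>i<k. g (\<epsilon> i)) = g 1 ^ j * g (-1) ^ (k - j)"
  using assms
proof (induction k)
  case (Suc k)
  then obtain j where j: "j \<le> k" "(\<Sum>i<k. \<epsilon> i) = 2 * int j - int k"
    "(\<Prod>i<k. g (\<epsilon> i)) = g 1 ^ j * g (-1) ^ (k - j)"
    by auto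
  consider "\<epsilon> k = 1" | "\<epsilon> k = -1" using Suc.prems by auto
  then show ?case
  proof cases
    case 1
    then show ?thesis using j by (intro exI[of _ "Suc j"]) simp
  next
    case 2
    then show ?thesis using j by (intro exI[of _ j]) (simp add: Suc_diff_le)
  qed
qed auto

lemma sum_spins: "(\<Sum>\<mu>\<in>spins k. f \<mu>) = (\<Sum>j\<le>k. f (2 * int j - int k))"
  unfolding spins_def by (subst sum.reindex) (auto simp: inj_on_def)

lemma sign_seq_prod:
  fixes g :: "int \<Rightarrow> complex"
  assumes "\<epsilon> \<in> sign_seqs k (2 * int j - int k)"
  shows "(\<Prod>i<k. g (\<epsilon> i)) = g 1 ^ j * g (-1) ^ (k - j)"
  using sign_seq_count[of k \<epsilon> g] assms by (fastforce simp: sign_seqs_def PiE_iff)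

text \<open>
  Expand each of the \<open>k\<close> factors along the path into its two terms, and collect the sign sequences
  with the same total.
\<close>
lemma nat_basis_psi_expansion:
  assumes \<tau>: "Im \<tau> > 0" and r: "r \<noteq> 0"
    and h: "h \<in> height_paths k a b" and ab: "a - b = int k - 2 * int n"
    and \<alpha>: "\<alpha> = (- u + of_int a - of_nat k + 1) / 2"
    and \<beta>: "\<beta> = (- u - of_int a - of_nat k + 1) / 2"
  shows "nat_basis \<tau> r k n \<alpha> \<beta> z
    = (\<Sum>j\<le>k. psi_along \<tau> r k (2 * int j - int k) u h
         * (spin_fun \<tau> r 1 z ^ j * spin_fun \<tau> r (-1) z ^ (k - j)))"
proof -
  define S where "S = {..<k} \<rightarrow>\<^sub>E {-1, 1 :: int}"
  define F where "F \<epsilon> = (\<Prod>i<k. psi \<tau> r (\<epsilon> i) (u + of_nat (k - 1 - i)) (h i) (h (Suc i)))" for \<epsilon>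
  define G where "G \<epsilon> = (\<Prod>i<k. spin_fun \<tau> r (\<epsilon> i) z)" for \<epsilon> :: "nat \<Rightarrow> int"
  have fin: "finite S"
    unfolding S_def by (intro finite_PiE) auto
  have "nat_basis \<tau> r k n \<alpha> \<beta> z
     = (\<Prod>i<k. \<Sum>\<epsilon>\<in>{-1, 1}. psi \<tau> r \<epsilon> (u + of_nat (k - 1 - i)) (h i) (h (Suc i)) * spin_fun \<tau> r \<epsilon> z)"
    unfolding step_fun_eq_sum_psi[OF \<tau> r] by (rule path_product_nat_basis[OF h ab \<alpha> \<beta>, symmetric])
  also have "\<dots> = (\<Sum>\<epsilon>\<in>S. F \<epsilon> * G \<epsilon>)"
    unfolding S_def F_def G_def prod.distrib[symmetric] by (rule prod_sum_PiE) auto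
  also have "\<dots> = (\<Sum>\<mu>\<in>spins k. \<Sum>\<epsilon>\<in>{\<epsilon> \<in> S. (\<Sum>i<k. \<epsilon> i) = \<mu>}. F \<epsilon> * G \<epsilon>)"
  proof (rule sum.group[symmetric, OF fin])
    show "finite (spins k)" by (simp add: spins_def)
    show "(\<lambda>\<epsilon>. \<Sum>i<k. \<epsilon> i) ` S \<subseteq> spins k"
    proof
      fix \<mu> assume "\<mu> \<in> (\<lambda>\<epsilon>. \<Sum>i<k. \<epsilon> i) ` S"
      then obtain \<epsilon> where "\<mu> = (\<Sum>i<k. \<epsilon> i)" "\<forall>i<k. \<epsilon> i \<in> {-1, 1}"
        by (auto simp: S_def PiE_iff)
      then show "\<mu> \<in> spins k"
        using sign_seq_count[of k \<epsilon> "\<lambda>_. 1"] by (auto simp: spins_def)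
    qed
  qed
  also have "\<dots> = (\<Sum>j\<le>k. \<Sum>\<epsilon>\<in>sign_seqs k (2 * int j - int k). F \<epsilon> * G \<epsilon>)"
    unfolding sum_spins S_def sign_seqs_def ..
  also have "\<dots> = (\<Sum>j\<le>k. psi_along \<tau> r k (2 * int j - int k) u h
         * (spin_fun \<tau> r 1 z ^ j * spin_fun \<tau> r (-1) z ^ (k - j)))"
    unfolding psi_along_def F_def[symmetric] sum_distrib_right
    by (intro sum.cong refl) (simp add: G_def sign_seq_prod[of _ _ _ "\<lambda>s. spin_fun \<tau> r s z"])
  finally show ?thesis .
qed

lemma path_endpoint:
  fixes h :: "nat \<Rightarrow> int"
  assumes "\<forall>i<k. \<bar>h i - h (Suc i)\<bar> = 1"
  shows "\<exists>l\<le>k. h k = h 0 - int k + 2 * int l"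
  using path_product[OF assms order_refl refl refl] by blast

text \<open>
  Only the start is prescribed here, whereas \<open>height_paths\<close> fixes both ends.
\<close>
definition free_paths :: "nat \<Rightarrow> int \<Rightarrow> (nat \<Rightarrow> int) set" where
  "free_paths k c = {h \<in> extensional {..k}. h 0 = c \<and> (\<forall>i<k. \<bar>h i - h (Suc i)\<bar> = 1)}"

lemma free_paths_0: "free_paths 0 c = {\<lambda>i. if i = 0 then c else undefined}"
  by (auto simp: free_paths_def extensional_def fun_eq_iff)

lemma bij_betw_free_paths_Suc:
  "bij_betw (\<lambda>(h, s). h(Suc k := h k + s)) (free_paths k c \<times> {-1, 1}) (free_paths (Suc k) c)"
proof (rule bij_betw_byWitness[where f' = "\<lambda>h. (restrict h {..k}, h (Suc k) - h k)"])
  show "\<forall>x\<in>free_paths k c \<times> {-1, 1}. (\<lambda>h. (restrict h {..k}, h (Suc k) - h k))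
      (case x of (h, s) \<Rightarrow> h(Suc k := h k + s)) = x"
    by (auto simp: free_paths_def extensional_def fun_eq_iff)
  show "\<forall>h\<in>free_paths (Suc k) c. (case (restrict h {..k}, h (Suc k) - h k) of
      (h, s) \<Rightarrow> h(Suc k := h k + s)) = h"
    by (auto simp: free_paths_def extensional_def fun_eq_iff restrict_def)
  show "(\<lambda>(h, s). h(Suc k := h k + s)) ` (free_paths k c \<times> {-1, 1}) \<subseteq> free_paths (Suc k) c"
    by (auto simp: free_paths_def extensional_def less_Suc_eq)
  show "(\<lambda>h. (restrict h {..k}, h (Suc k) - h k)) ` free_paths (Suc k) c \<subseteq> free_paths k c \<times> {-1, 1}"
    by (auto simp: free_paths_def abs_if split: if_splits)
qed

lemma finite_free_paths: "finite (free_paths k c)"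
proof (induction k)
  case (Suc k)
  then show ?case
    using bij_betw_finite[OF bij_betw_free_paths_Suc[of k c]] by simp
qed (simp add: free_paths_0)

lemma free_paths_range: "h \<in> free_paths k c \<Longrightarrow> i \<le> k \<Longrightarrow> \<bar>h i - c\<bar> \<le> int i"
proof (induction i)
  case (Suc i)
  then have "\<bar>h i - h (Suc i)\<bar> = 1" "\<bar>h i - c\<bar> \<le> int i"
    by (auto simp: free_paths_def)
  then show ?case by linarith
qed (simp add: free_paths_def)

text \<open>
  The last step of a path can be summed first; if the result is the same for every height that the
  path may have reached, the sum over paths collapses step by step.
\<close>
lemma sum_free_paths:
  fixes w :: "nat \<Rightarrow> int \<Rightarrow> int \<Rightarrow> complex"
  assumes "\<And>i e. i < k \<Longrightarrow> \<bar>e - c\<bar> \<le> int i \<Longrightarrow> (\<Sum>s\<in>{-1, 1}. w i e (e + s)) = X i"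
  shows "(\<Sum>h\<in>free_paths k c. \<Prod>i<k. w i (h i) (h (Suc i))) = (\<Prod>i<k. X i)"
  using assms
proof (induction k)
  case 0
  then show ?case by (simp add: free_paths_0)
next
  case (Suc k)
  have "(\<Sum>h\<in>free_paths (Suc k) c. \<Prod>i<Suc k. w i (h i) (h (Suc i)))
     = (\<Sum>(h, s)\<in>free_paths k c \<times> {-1, 1}. (\<Prod>i<k. w i (h i) (h (Suc i))) * w k (h k) (h k + s))"
    by (subst sum.reindex_bij_betw[OF bij_betw_free_paths_Suc, symmetric])
       (auto intro!: sum.cong prod.cong)
  also have "\<dots> = (\<Sum>h\<in>free_paths k c. (\<Prod>i<k. w i (h i) (h (Suc i))) * (\<Sum>s\<in>{-1, 1}. w k (h k) (h k + s)))"
    unfolding sum_distrib_left by (rule sum.cartesian_product[symmetric])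
  also have "\<dots> = (\<Sum>h\<in>free_paths k c. (\<Prod>i<k. w i (h i) (h (Suc i))) * X k)"
  proof (rule sum.cong, rule refl)
    fix h assume "h \<in> free_paths k c"
    then have "(\<Sum>s\<in>{-1, 1}. w k (h k) (h k + s)) = X k"
      using free_paths_range[of h k c k] by (intro Suc.prems) auto
    then show "(\<Prod>i<k. w i (h i) (h (Suc i))) * (\<Sum>s\<in>{-1, 1}. w k (h k) (h k + s))
       = (\<Prod>i<k. w i (h i) (h (Suc i))) * X k" by simp
  qed
  also have "\<dots> = (\<Prod>i<Suc k. X i)"
    using Suc by (simp flip: sum_distrib_right)
  finally show ?case .
qed


lemma sum_free_paths_by_endpoint:
  fixes f :: "(nat \<Rightarrow> int) \<Rightarrow> complex"
  shows "(\<Sum>h\<in>free_paths k c. f h) = (\<Sum>l\<le>k. \<Sum>h\<in>height_paths k c (c - int k + 2 * int l). f h)"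
proof -
  have "(\<Sum>h\<in>free_paths k c. f h)
     = (\<Sum>d\<in>(\<lambda>l. c - int k + 2 * int l) ` {..k}. \<Sum>h\<in>{h \<in> free_paths k c. h k = d}. f h)"
  proof (rule sum.group[symmetric, OF finite_free_paths])
    show "(\<lambda>h. h k) ` free_paths k c \<subseteq> (\<lambda>l. c - int k + 2 * int l) ` {..k}"
    proof
      fix d assume "d \<in> (\<lambda>h. h k) ` free_paths k c"
      then obtain h where "h k = d" "h 0 = c" "\<forall>i<k. \<bar>h i - h (Suc i)\<bar> = 1"
        by (auto simp: free_paths_def)
      then show "d \<in> (\<lambda>l. c - int k + 2 * int l) ` {..k}"
        using path_endpoint[of k h] by fastforce
    qed
  qed simp
  also have "\<dots> = (\<Sum>l\<le>k. \<Sum>h\<in>{h \<in> free_paths k c. h k = c - int k + 2 * int l}. f h)"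
    by (subst sum.reindex) (auto simp: inj_on_def)
  also have "\<dots> = (\<Sum>l\<le>k. \<Sum>h\<in>height_paths k c (c - int k + 2 * int l). f h)"
    by (intro sum.cong refl) (auto simp: free_paths_def height_paths_def)
  finally show ?thesis .
qed

text \<open>
  By the inverse relation, each factor \<open>X\<^sub>\<epsilon>\<close> is a sum over the two possible next heights, from every
  current height.  The product of \<open>k\<close> of them is thus a sum over all paths from \<open>c\<close>, and along
  a path with a given end point the steps multiply to a function of the natural basis.  Before the last step
  a path stays within distance \<open>k-1\<close> of \<open>c\<close>, which is where the brackets in the denominators must not vanish.
\<close>
lemma spin_product_psi_star_expansion:
  assumes \<tau>: "Im \<tau> > 0" and r: "r \<noteq> 0" and \<epsilon>: "\<epsilon> \<in> sign_seqs k (2 * int j - int k)"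
    and nz: "\<forall>j\<in>{1 - int k..int k - 1}. bracket \<tau> r (of_int (c + j)) \<noteq> 0"
      "\<forall>j<k. bracket \<tau> r (u + of_nat j) \<noteq> 0"
    and \<gamma>: "\<gamma> = (- u + of_int c - of_nat k + 1) / 2"
    and \<delta>: "\<delta> = (- u - of_int c - of_nat k + 1) / 2"
  shows "spin_fun \<tau> r 1 z ^ j * spin_fun \<tau> r (-1) z ^ (k - j)
    = (\<Sum>l\<le>k. psi_star_along \<tau> r k \<epsilon> u (c - int k + 2 * int l) c * nat_basis \<tau> r k l \<gamma> \<delta> z)"
proof -
  define w where "w i e e' = psi_star \<tau> r (\<epsilon> i) (u + of_nat (k - 1 - i)) e' e
      * step_fun \<tau> r (u + of_nat (k - 1 - i)) e e' z" for i e e'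
  have "spin_fun \<tau> r 1 z ^ j * spin_fun \<tau> r (-1) z ^ (k - j) = (\<Prod>i<k. spin_fun \<tau> r (\<epsilon> i) z)"
    using sign_seq_prod[OF \<epsilon>, of "\<lambda>s. spin_fun \<tau> r s z"] by simp
  also have "\<dots> = (\<Sum>h\<in>free_paths k c. \<Prod>i<k. w i (h i) (h (Suc i)))"
  proof (rule sum_free_paths[symmetric])
    fix i e assume i: "i < k" and e: "\<bar>e - c\<bar> \<le> int i"
    have "\<epsilon> i \<in> {-1, 1}"
      using \<epsilon> i by (auto simp: sign_seqs_def PiE_iff)
    moreover have "e - c \<in> {1 - int k..int k - 1}"
      using e i by auto
    then have "bracket \<tau> r (of_int (c + (e - c))) \<noteq> 0"
      using nz(1) by blast
    moreover have "bracket \<tau> r (u + of_nat (k - 1 - i)) \<noteq> 0"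
      using nz(2)[rule_format, of "k - 1 - i"] i by simp
    ultimately show "(\<Sum>s\<in>{-1, 1}. w i e (e + s)) = spin_fun \<tau> r (\<epsilon> i) z"
      unfolding w_def by (intro spin_fun_eq_sum_psi_star \<tau> r) (simp_all del: of_nat_diff)
  qed
  also have "\<dots> = (\<Sum>l\<le>k. \<Sum>h\<in>height_paths k c (c - int k + 2 * int l). \<Prod>i<k. w i (h i) (h (Suc i)))"
    by (rule sum_free_paths_by_endpoint)
  also have "\<dots> = (\<Sum>l\<le>k. psi_star_along \<tau> r k \<epsilon> u (c - int k + 2 * int l) c * nat_basis \<tau> r k l \<gamma> \<delta> z)"
    unfolding psi_star_along_def sum_distrib_right
  proof (intro sum.cong refl)
    fix l h assume "h \<in> height_paths k c (c - int k + 2 * int l)"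
    then have "(\<Prod>i<k. step_fun \<tau> r (u + of_nat (k - 1 - i)) (h i) (h (Suc i)) z) = nat_basis \<tau> r k l \<gamma> \<delta> z"
      by (rule path_product_nat_basis[OF _ _ \<gamma> \<delta>]) simp
    then show "(\<Prod>i<k. w i (h i) (h (Suc i)))
        = (\<Prod>i<k. psi_star \<tau> r (\<epsilon> i) (u + of_nat (k - 1 - i)) (h (Suc i)) (h i)) * nat_basis \<tau> r k l \<gamma> \<delta> z"
      by (simp only: w_def prod.distrib)
  qed
  finally show ?thesis .
qed

section \<open>Linear independence\<close>

text \<open>
  The zeros of \<open>\<vartheta>\<^sub>3(\<sqdot>|\<sigma>)\<close> have imaginary part in \<open>(\<int> + 1/2) Im \<sigma>\<close>.
\<close>
lemma theta3_real_nonzero: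
  assumes "Im \<tau> > 0"
  shows "theta3 (of_real x) (\<tau> / 2) \<noteq> 0"
proof -
  have "of_real x + (\<tau> / 2 + 1) / 2 \<notin> period_lattice (\<tau> / 2)"
  proof
    assume "of_real x + (\<tau> / 2 + 1) / 2 \<in> period_lattice (\<tau> / 2)"
    then obtain s t :: int where "of_real x + (\<tau> / 2 + 1) / 2 = of_int s + of_int t * (\<tau> / 2)"
      by (auto simp: period_lattice_def)
    then have "Im \<tau> / 4 = of_int t * (Im \<tau> / 2)"
      by (simp add: complex_eq_iff)
    then have "1 = 2 * real_of_int t"
      using assms by (simp add: field_simps)
    then have "1 = 2 * t"
      by linarith
    then show False
      by presburger
  qed
  then show ?thesis
    using theta1_nonzero[of "\<tau> / 2"] assms by (simp add: theta3_def)
qed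

text \<open>
  Two equal ratios make the left-hand side of the addition formula vanish, hence \<open>x + y\<close> or \<open>x - y\<close> is
  a real lattice point, that is, an integer.
\<close>
lemma theta_ratio_inj:
  assumes \<tau>: "Im \<tau> > 0"
  shows "inj_on (\<lambda>x. theta0 (of_real x) (\<tau> / 2) / theta3 (of_real x) (\<tau> / 2)) {0<..<1/2}"
proof (rule inj_onI)
  fix x y :: real
  assume xy: "x \<in> {0<..<1/2}" "y \<in> {0<..<1/2}"
    and eq: "theta0 (of_real x) (\<tau> / 2) / theta3 (of_real x) (\<tau> / 2)
      = theta0 (of_real y) (\<tau> / 2) / theta3 (of_real y) (\<tau> / 2)"
  have "theta1 (of_real x + of_real y) \<tau> * theta1 (of_real x - of_real y) \<tau> = 0"
    using eq theta_addition[OF \<tau>, of "of_real x" "of_real y"]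
      theta3_real_nonzero[OF \<tau>, of x] theta3_real_nonzero[OF \<tau>, of y]
    by (simp add: field_simps)
  then obtain w :: real where w: "w = x + y \<or> w = x - y" "theta1 (of_real w) \<tau> = 0"
    by (metis mult_eq_0_iff of_real_add of_real_diff)
  then have "of_real w \<in> period_lattice \<tau>"
    using theta1_nonzero[OF \<tau>] by blast
  then obtain s t :: int where st: "of_real w = of_int s + of_int t * \<tau>"
    by (auto simp: period_lattice_def)
  then have "of_int t * Im \<tau> = 0"
    by (simp add: complex_eq_iff)
  then have "w = of_int s"
    using \<tau> st by (simp add: complex_eq_iff)
  moreover have "- 1 < w" "w < 1" "w = x + y \<Longrightarrow> w > 0"
    using w(1) xy by auto
  ultimately have "w = 0" "w \<noteq> x + y"
    by auto
  then show "x = y"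
    using w(1) by simp
qed

text \<open>
  At real \<open>z\<close> one can divide by the \<open>k\<close>-th power of \<open>\<vartheta>\<^sub>3\<close>.  A linear relation between the monomials
  becomes a polynomial equation for \<open>\<vartheta>\<^sub>0/\<vartheta>\<^sub>3\<close>, which has infinitely many solutions.
\<close>
lemma spin_monomials_independent:
  assumes \<tau>: "Im \<tau> > 0"
    and zero: "\<And>z. (\<Sum>j\<le>k. c j * (spin_fun \<tau> r 1 z ^ j * spin_fun \<tau> r (-1) z ^ (k - j))) = 0"
    and j: "j \<le> k"
  shows "c j = 0"
proof -
  define K where "K = (theta_const \<tau> r)\<^sup>2 / 2"
  have K: "K \<noteq> 0"
    using theta_const_nonzero[of \<tau> r] \<tau> by (cases "\<tau> = 0") (simp_all add: K_def)
  define t where "t x = theta0 (of_real x) (\<tau> / 2) / theta3 (of_real x) (\<tau> / 2)" for x :: real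
  \<comment> \<open>the coefficients of the relation after division by the \<open>k\<close>-th power of \<open>\<vartheta>\<^sub>3\<close>; the sign is that of \<open>X\<^sub>-\<close>\<close>
  define C where "C i = c (k - i) * (-1) ^ i" for i
  have root: "(\<Sum>i\<le>k. C i * t x ^ i) = 0" for x
  proof -
    define A where "A = theta3 (of_real x) (\<tau> / 2)"
    define B where "B = theta0 (of_real x) (\<tau> / 2)"
    have A: "A \<noteq> 0"
      using theta3_real_nonzero[OF \<tau>] by (simp add: A_def)
    have sp: "spin_fun \<tau> r 1 (of_real x) = K * A" "spin_fun \<tau> r (-1) (of_real x) = - (K * B)"
      by (simp_all add: spin_fun_def half_theta_def K_def A_def B_def)
    have "(K * A) ^ k * (\<Sum>i\<le>k. C i * t x ^ i) = (\<Sum>i\<le>k. c (k - i) * ((K * A) ^ (k - i) * (- (K * B)) ^ i))"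
      unfolding sum_distrib_left
    proof (rule sum.cong, rule refl)
      fix i assume "i \<in> {..k}"
      then have "(K * A) ^ k = (K * A) ^ (k - i) * (K * A) ^ i"
        by (simp flip: power_add)
      then have "(K * A) ^ k * (C i * t x ^ i)
          = c (k - i) * ((K * A) ^ (k - i) * ((K * A) ^ i * t x ^ i * (- 1) ^ i))"
        by (simp only: C_def mult_ac)
      also have "(K * A) ^ i * t x ^ i * (- 1) ^ i = (K * A * t x * (- 1)) ^ i"
        by (simp only: power_mult_distrib)
      also have "K * A * t x * (- 1) = - (K * B)"
        using A by (simp add: t_def A_def B_def)
      finally show "(K * A) ^ k * (C i * t x ^ i) = c (k - i) * ((K * A) ^ (k - i) * (- (K * B)) ^ i)" .
    qed
    also have "\<dots> = (\<Sum>j\<le>k. c j * ((K * A) ^ j * (- (K * B)) ^ (k - j)))"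
      by (rule sum.reindex_bij_witness[of _ "\<lambda>j. k - j" "\<lambda>i. k - i"]) auto
    also have "\<dots> = 0"
      using zero[of "of_real x"] by (simp add: sp)
    finally show ?thesis
      using K A by simp
  qed
  have "infinite (t ` {0<..<1/2})"
    using finite_imageD[OF _ theta_ratio_inj[OF \<tau>]] infinite_Ioo[of 0 "1/2 :: real"]
    unfolding t_def by auto
  moreover have "t ` {0<..<1/2} \<subseteq> {s. (\<Sum>i\<le>k. C i * s ^ i) = 0}"
    using root by auto
  ultimately have "infinite {s. (\<Sum>i\<le>k. C i * s ^ i) = 0}"
    using finite_subset by blast
  then have "C (k - j) = 0"
    unfolding polyfun_finite_roots by auto
  then show ?thesis
    using j by (simp add: C_def)
qed

text \<open>
  Functions form a vector space over the complex numbers with pointwise operations; the exchange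
  lemma for abstract vector spaces then applies to them.
\<close>
interpretation fun_vs: vector_space "\<lambda>(c::complex) (f :: complex \<Rightarrow> complex) z. c * f z"
  by unfold_locales (auto simp: fun_eq_iff algebra_simps)

text \<open>
  If one of the \<open>k+1\<close> functions \<open>E\<^sub>l\<close> depended on the others, the \<open>k+1\<close> independent functions \<open>X\<^sub>j\<close> would
  lie in the span of \<open>k\<close> functions.
\<close>
lemma independent_if_spans_independent:
  fixes X E :: "nat \<Rightarrow> complex \<Rightarrow> complex"
  assumes indep: "\<And>c j. (\<And>z. (\<Sum>j\<le>k. c j * X j z) = 0) \<Longrightarrow> j \<le> k \<Longrightarrow> c j = 0"
    and XE: "\<And>j z. j \<le> k \<Longrightarrow> X j z = (\<Sum>l\<le>k. S j l * E l z)"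
    and rel: "\<And>z. (\<Sum>l\<le>k. R l * E l z) = 0"
    and l: "l \<le> k"
  shows "R l = 0"
proof (rule ccontr)
  assume R: "R l \<noteq> 0"
  define E' where "E' = E ` ({..k} - {l})"
  have fin: "finite E'" and card: "card E' \<le> k"
  proof -
    show "finite E'" by (simp add: E'_def)
    have "card E' \<le> card ({..k} - {l})"
      unfolding E'_def by (rule card_image_le) simp
    then show "card E' \<le> k" using l by simp
  qed
  have sum_fun: "(\<Sum>i\<in>I. (\<lambda>z. a i * F i z)) = (\<lambda>z. \<Sum>i\<in>I. a i * F i z)"
    for I and a :: "nat \<Rightarrow> complex" and F :: "nat \<Rightarrow> complex \<Rightarrow> complex"
    by (induction I rule: infinite_finite_induct) (auto simp: fun_eq_iff)
  have others: "E i \<in> fun_vs.span E'" if "i \<le> k" "i \<noteq> l" for i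
    using that by (intro fun_vs.span_base) (auto simp: E'_def)
  have "E l = (\<Sum>i\<in>{..k} - {l}. (\<lambda>z. (- R i / R l) * E i z))"
  proof
    fix z
    have "R l * E l z + (\<Sum>i\<in>{..k} - {l}. R i * E i z) = 0"
      using rel[of z] l by (simp add: sum.remove)
    then have "E l z = - (\<Sum>i\<in>{..k} - {l}. R i * E i z) / R l"
      using R by (simp add: field_simps add_eq_0_iff)
    also have "\<dots> = (\<Sum>i\<in>{..k} - {l}. (- R i / R l) * E i z)"
      by (simp add: sum_negf sum_divide_distrib)
    finally show "E l z = (\<Sum>i\<in>{..k} - {l}. (\<lambda>z. (- R i / R l) * E i z)) z"
      unfolding sum_fun .
  qed
  moreover have "(\<Sum>i\<in>{..k} - {l}. (\<lambda>z. (- R i / R l) * E i z)) \<in> fun_vs.span E'"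
    by (rule fun_vs.span_sum, rule fun_vs.span_scale, rule others) auto
  ultimately have all: "E i \<in> fun_vs.span E'" if "i \<le> k" for i
    using that others by (cases "i = l") auto
  have "X j \<in> fun_vs.span E'" if "j \<le> k" for j
  proof -
    have "X j = (\<Sum>i\<le>k. (\<lambda>z. S j i * E i z))"
      unfolding sum_fun using XE[OF that] by auto
    then show ?thesis
      by (simp only:) (rule fun_vs.span_sum, rule fun_vs.span_scale, rule all, simp)
  qed
  then have sub: "X ` {..k} \<subseteq> fun_vs.span E'"
    by auto
  have inj: "inj_on X {..k}"
  proof (rule inj_onI)
    fix i j assume ij: "i \<in> {..k}" "j \<in> {..k}" "X i = X j"
    show "i = j"
    proof (rule ccontr)
      assume ne: "i \<noteq> j"
      define c where "c m = (if m = i then 1 else if m = j then - 1 else 0 :: complex)" for m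
      have "(\<Sum>m\<le>k. c m * X m z) = 0" for z
      proof -
        have "(\<Sum>m\<le>k. c m * X m z) = (\<Sum>m\<in>{i, j}. c m * X m z)"
          by (rule sum.mono_neutral_right) (use ij in \<open>auto simp: c_def\<close>)
        then show ?thesis
          using ne ij(3) by (simp add: c_def)
      qed
      then have "c i = 0" using indep[of c i] ij by auto
      then show False by (simp add: c_def)
    qed
  qed
  have "fun_vs.independent (X ` {..k})"
  proof (rule fun_vs.independent_if_scalars_zero)
    fix a f
    assume a: "(\<Sum>f\<in>X ` {..k}. (\<lambda>z. a f * f z)) = 0" and f: "f \<in> X ` {..k}"
    have "(\<Sum>j\<le>k. a (X j) * X j z) = 0" for z
    proof -
      have "(\<Sum>j\<le>k. (\<lambda>z. a (X j) * X j z)) = 0"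
        using a by (simp add: sum.reindex[OF inj])
      then show ?thesis
        unfolding sum_fun by (simp add: fun_eq_iff)
    qed
    then show "a f = 0"
      using indep[of "\<lambda>j. a (X j)"] f by auto
  qed simp
  from fun_vs.independent_span_bound[OF fin this sub] show False
    using card by (simp add: card_image[OF inj])
qed

section \<open>The sum formula for elliptic 6j-symbols\<close>

lemma height_paths_nonempty:
  assumes "l \<le> k"
  shows "height_paths k c (c - int k + 2 * int l) \<noteq> {}"
proof -
  \<comment> \<open>all up steps first\<close>
  define h where "h = restrict (\<lambda>i. if i \<le> l then c + int i else c + 2 * int l - int i) {..k}"
  have "h \<in> height_paths k c (c - int k + 2 * int l)"
    using assms by (auto simp: height_paths_def h_def)
  then show ?thesis by blast
qed

lemma sign_seqs_nonempty:
  assumes "j \<le> k"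
  shows "sign_seqs k (2 * int j - int k) \<noteq> {}"
proof -
  define \<epsilon> where "\<epsilon> = restrict (\<lambda>i. if i < j then 1 else -1 :: int) {..<k}"
  have "(\<Sum>i<k. \<epsilon> i) = (\<Sum>i<k. if i < j then 1 else - 1)"
    by (rule sum.cong) (auto simp: \<epsilon>_def)
  also have "\<dots> = 2 * int (min j k) - int k"
    by (induction k) (auto simp: min_def)
  also have "\<dots> = 2 * int j - int k"
    using assms by simp
  finally have "\<epsilon> \<in> sign_seqs k (2 * int j - int k)"
    by (auto simp: sign_seqs_def \<epsilon>_def)
  then show ?thesis by blast
qed

theorem theorem3p4:
  fixes \<tau> r u \<alpha> \<beta> \<gamma> \<delta> :: complex
    and k n m :: nat
    and a b c d :: int
  assumes "Im \<tau> > 0"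
    and "r \<noteq> 0"
    and "k \<ge> 1" and "n \<le> k" and "m \<le> k"
    and "a - b = int k - 2 * int n"
    and "c - d = int k - 2 * int m"
    and "\<alpha> = (- u + of_int a - of_nat k + 1) / 2"
    and "\<beta> = (- u - of_int a - of_nat k + 1) / 2"
    and "\<gamma> = (- u + of_int c - of_nat k + 1) / 2"
    and "\<delta> = (- u - of_int c - of_nat k + 1) / 2"
    and "\<forall>j\<in>{1 - int k..int k - 1}. of_int (c + j) / r \<notin> period_lattice \<tau>"
    and "\<forall>j<k. (u + of_nat j) / r \<notin> period_lattice \<tau>"
  shows "elliptic_6j \<tau> r k n m \<alpha> \<beta> \<gamma> \<delta> =
    (\<Sum>\<mu>\<in>spins k. psi_star_fused \<tau> r k \<mu> u d c * psi_fused \<tau> r k \<mu> u a b)"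
proof -
  note \<tau> = assms(1) and r = assms(2) and ab = assms(6) and cd = assms(7)
    and \<alpha> = assms(8) and \<beta> = assms(9) and \<gamma> = assms(10) and \<delta> = assms(11)
  have nz: "\<forall>j\<in>{1 - int k..int k - 1}. bracket \<tau> r (of_int (c + j)) \<noteq> 0"
    "\<forall>j<k. bracket \<tau> r (u + of_nat j) \<noteq> 0"
    using bracket_nonzero[OF \<tau>] assms(12,13) by blast+
  define X where "X j z = spin_fun \<tau> r 1 z ^ j * spin_fun \<tau> r (-1) z ^ (k - j)" for j z
  define E where "E l z = nat_basis \<tau> r k l \<gamma> \<delta> z" for l z
  \<comment> \<open>the end point of the paths from \<open>c\<close> with \<open>l\<close> up steps, and the total of \<open>j\<close> plus signs\<close>
  define e where "e l = c - int k + 2 * int l" for l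
  define \<mu> where "\<mu> j = 2 * int j - int k" for j
  have X_indep: "f j = 0" if "\<And>z. (\<Sum>j\<le>k. f j * X j z) = 0" "j \<le> k" for f j
    using spin_monomials_independent[OF \<tau>, where k = k and c = f and r = r and j = j] that unfolding X_def by blast
  have X_E: "X j z = (\<Sum>l\<le>k. psi_star_along \<tau> r k \<epsilon> u (e l) c * E l z)"
    if "\<epsilon> \<in> sign_seqs k (\<mu> j)" for j \<epsilon> z
    using spin_product_psi_star_expansion[OF \<tau> r _ nz \<gamma> \<delta>] that
    unfolding X_def E_def e_def \<mu>_def by blast
  have "\<forall>j. \<exists>\<epsilon>. j \<le> k \<longrightarrow> \<epsilon> \<in> sign_seqs k (\<mu> j)"
    using sign_seqs_nonempty unfolding \<mu>_def by blast
  then obtain sg where sg: "\<And>j. j \<le> k \<Longrightarrow> sg j \<in> sign_seqs k (\<mu> j)"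
    by metis
  \<comment> \<open>Any choice of signs shows that the \<open>E\<close> span the \<open>X\<close>; their independence then shows that the
    coefficients do not depend on this choice.\<close>
  have E_indep: "R l = 0" if "\<And>z. (\<Sum>l\<le>k. R l * E l z) = 0" "l \<le> k" for R l
    using independent_if_spans_independent[where X = X and E = E and R = R and k = k and l = l
        and S = "\<lambda>j l. psi_star_along \<tau> r k (sg j) u (e l) c"]
      X_indep X_E sg that by blast
  have X_unique: "f j = g j"
    if "\<And>z. (\<Sum>j\<le>k. f j * X j z) = (\<Sum>j\<le>k. g j * X j z)" "j \<le> k" for f g j
    using X_indep[of "\<lambda>j. f j - g j" j] that by (simp add: left_diff_distrib sum_subtractf)
  have E_unique: "f l = g l"
    if "\<And>z. (\<Sum>l\<le>k. f l * E l z) = (\<Sum>l\<le>k. g l * E l z)" "l \<le> k" for f g l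
    using E_indep[of "\<lambda>l. f l - g l" l] that by (simp add: left_diff_distrib sum_subtractf)
  have "b = a - int k + 2 * int n"
    using ab by simp
  then obtain h where h: "h \<in> height_paths k a b"
    using height_paths_nonempty[OF assms(4)] by blast
  define P where "P j = psi_along \<tau> r k (\<mu> j) u h" for j
  define S where "S j l = psi_star_along \<tau> r k (sg j) u (e l) c" for j l
  have e_X: "nat_basis \<tau> r k n \<alpha> \<beta> z = (\<Sum>j\<le>k. psi_along \<tau> r k (\<mu> j) u h' * X j z)"
    if "h' \<in> height_paths k a b" for h' z
    unfolding X_def \<mu>_def by (rule nat_basis_psi_expansion[OF \<tau> r that ab \<alpha> \<beta>])
  have P: "psi_fused \<tau> r k (\<mu> j) u a b = P j" if j: "j \<le> k" for j
    unfolding psi_fused_def P_def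
  proof (rule the_elem_image_unique)
    show "height_paths k a b \<noteq> {}"
      using h by blast
    fix h' assume h': "h' \<in> height_paths k a b"
    show "psi_along \<tau> r k (\<mu> j) u h' = psi_along \<tau> r k (\<mu> j) u h"
      by (rule X_unique[where f = "\<lambda>j. psi_along \<tau> r k (\<mu> j) u h'" and g = "\<lambda>j. psi_along \<tau> r k (\<mu> j) u h", OF _ j])
         (simp only: e_X[OF h, symmetric] e_X[OF h', symmetric])
  qed
  have S: "psi_star_fused \<tau> r k (\<mu> j) u (e l) c = S j l" if j: "j \<le> k" and l: "l \<le> k" for j l
    unfolding psi_star_fused_def S_def
  proof (rule the_elem_image_unique)
    show "sign_seqs k (\<mu> j) \<noteq> {}"
      using sg[OF j] by blast
    fix \<epsilon> assume \<epsilon>: "\<epsilon> \<in> sign_seqs k (\<mu> j)"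
    show "psi_star_along \<tau> r k \<epsilon> u (e l) c = psi_star_along \<tau> r k (sg j) u (e l) c"
      by (rule E_unique[where f = "\<lambda>l. psi_star_along \<tau> r k \<epsilon> u (e l) c"
            and g = "\<lambda>l. psi_star_along \<tau> r k (sg j) u (e l) c", OF _ l])
         (simp only: X_E[OF \<epsilon>, symmetric] X_E[OF sg[OF j], symmetric])
  qed
  define R where "R = restrict (\<lambda>l. \<Sum>j\<le>k. S j l * P j) {..k}"
  have expansion: "nat_basis \<tau> r k n \<alpha> \<beta> z = (\<Sum>l\<le>k. R l * E l z)" for z
  proof -
    have "nat_basis \<tau> r k n \<alpha> \<beta> z = (\<Sum>j\<le>k. P j * (\<Sum>l\<le>k. S j l * E l z))"
      unfolding e_X[OF h] P_def S_def using X_E sg by (intro sum.cong) auto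
    also have "\<dots> = (\<Sum>l\<le>k. \<Sum>j\<le>k. P j * (S j l * E l z))"
      unfolding sum_distrib_left by (rule sum.swap)
    also have "\<dots> = (\<Sum>l\<le>k. R l * E l z)"
      by (intro sum.cong refl) (simp add: R_def sum_distrib_left mult_ac)
    finally show ?thesis .
  qed
  have "(THE R. R \<in> extensional {..k} \<and> (\<forall>z. nat_basis \<tau> r k n \<alpha> \<beta> z = (\<Sum>l\<le>k. R l * E l z))) = R"
  proof (rule the_equality)
    show "R \<in> extensional {..k} \<and> (\<forall>z. nat_basis \<tau> r k n \<alpha> \<beta> z = (\<Sum>l\<le>k. R l * E l z))"
      using expansion by (simp add: R_def)
  next
    fix R' assume R': "R' \<in> extensional {..k} \<and> (\<forall>z. nat_basis \<tau> r k n \<alpha> \<beta> z = (\<Sum>l\<le>k. R' l * E l z))"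
    have "R' l = R l" if "l \<le> k" for l
      by (rule E_unique[OF _ that]) (use R' expansion in auto)
    then show "R' = R"
      using R' by (intro extensionalityI[of R' "{..k}" R]) (auto simp: R_def)
  qed
  then have "elliptic_6j \<tau> r k n m \<alpha> \<beta> \<gamma> \<delta> = R m"
    by (simp only: elliptic_6j_def E_def)
  also have "\<dots> = (\<Sum>j\<le>k. psi_star_fused \<tau> r k (\<mu> j) u (e m) c * psi_fused \<tau> r k (\<mu> j) u a b)"
    using assms(5) by (simp add: R_def P S)
  also have "e m = d"
    using cd by (simp add: e_def)
  finally show ?thesis
    unfolding sum_spins \<mu>_def .
qed

end
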